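(* Let $F=\alpha+\beta$ be a Randers metric on an $n$-dimensional manifold $M$, where $\alpha=\sqrt{a_{ij}y^iy^j}$ is a Riemannian metric and $\beta=b_iy^i$ is a $1$-form with $\|\beta\|_\alpha<1$. Then $F$ is projectively Ricci-flat if and only if there is a scalar function $h$ on $M$ such that $$\mathbf{Ric}_\alpha = 2s_{0m}s^m_{\ 0}+\alpha^2 s^i_{\ j}s^j_{\ i}-(n-1)\big[h_{0;0}+(h_0)^2\big],$$ $$s^m_{\ 0;m}=(n-1)h_{x^m}s^m_{\ 0},$$ where $\mathbf{Ric}_\alpha$ denotes the Ricci curvature of $\alpha$.
   Context: Let $M$ be an $n$-dimensional smooth manifold, $(x^i)$ local coordinates on $M$ and $(x^i,y^i)$ the induced coordinates on $TM$; repeated indices are summed. Sprays. A spray $\mathbf{G}$ on $M$ is a smooth vector field on $TM_0=TM\setminus\{0\}$ which in every standard local coordinate system has the form $\mathbf{G}=y^i\frac{\partial}{\partial x^i}-2G^i(x,y)\frac{\partial}{\partial y^i}$ with $G^i(x,\lambda y)=\lambda^2G^i(x,y)$ for all $\lambda>0$. Its Riemann curvature is $$R^i_{\ k}=2\frac{\partial G^i}{\partial x^k}-y^j\frac{\partial^2G^i}{\partial x^j\partial y^k}+2G^j\frac{\partial^2G^i}{\partial y^j\partial y^k}-\frac{\partial G^i}{\partial y^s}\frac{\partial G^s}{\partial y^k},$$ and its Ricci curvature is $\mathbf{Ric}_{\mathbf{G}}:=R^m_{\ m}$, a function on $TM_0$. A volume form on $M$ is written locally as $dV=\sigma(x)\,dx^1\cdots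 dx^n$ with $\sigma>0$ smooth. The S-curvature of $(\mathbf{G},dV)$ is $\mathbf{S}_{(\mathbf{G},dV)}:=\frac{\partial G^m}{\partial y^m}-y^m\frac{\partial}{\partial x^m}(\ln\sigma)$. The projective spray of $(\mathbf{G},dV)$ is $\hat{\mathbf{G}}:=\mathbf{G}+\frac{2\mathbf{S}}{n+1}\mathbf{Y}$ with $\mathbf{Y}=y^i\frac{\partial}{\partial y^i}$, i.e. $\hat G^i=G^i-\frac{\mathbf{S}}{n+1}y^i$. The projective Ricci curvature is $\mathbf{PRic}_{(\mathbf{G},dV)}:=\mathbf{Ric}_{\hat{\mathbf{G}}}$. A spray $\mathbf{G}$ is projectively Ricci-flat if there is a volume form $dV$ on $M$ with $\mathbf{PRic}_{(\mathbf{G},dV)}=0$. Finsler metrics. A Finsler metric $F$ induces a spray $\mathbf{G}_F$ with coefficients $G^i=\frac14g^{il}\{[F^2]_{x^ky^l}y^k-[F^2]_{x^l}\}$, where $g_{ij}=\frac12[F^2]_{y^iy^j}$ and $(g^{ij})=(g_{ij})^{-1}$. $F$ is projectively Ricci-flat if $\mathbf{G}_F$ is. Notation for Randers metrics. $\mathbf{Ric}_\alpha$ is the Ricci curvature of (the spray of) $\alpha$, i.e. the quadratic form $\mathbf{Ric}_\alpha(y,y)$ of the Ricci tensor of $\alpha$. The symbol ";" denotes the covariant derivative with respect to the Levi-Civita connection of $\alpha$; $s_{ij}:=\frac12(b_{i;j}-b_{j;i})$; indices are raised with $a^{ij}$, so $s^i_{\ j}=a^{il}s_{lj}$. The index "$0$"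 denotes contraction with $y$: $s_{0m}=s_{im}y^i$, $s^m_{\ 0}=s^m_{\ j}y^j$, $s^m_{\ 0;m}=s^m_{\ j;m}y^j$. For a smooth scalar function $h=h(x)$ on $M$, $h_{x^m}=\frac{\partial h}{\partial x^m}$, $h_0=h_{x^m}y^m$, and $h_{0;0}=h_{i;j}y^iy^j$ is the Hessian of $h$ with respect to $\alpha$ evaluated at $(y,y)$. The equations are required to hold for all $x\in M$ and $y\in T_xM$. *)

theory Defs
  imports "HOL-Analysis.Analysis"
begin

section \<open>Smooth functions\<close>

primrec Ck_on :: "nat \<Rightarrow> 'a::real_normed_vector set \<Rightarrow> ('a \<Rightarrow> 'b::real_normed_vector) \<Rightarrow> bool" where
  "Ck_on 0 S f \<longleftrightarrow> continuous_on S f"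
| "Ck_on (Suc k) S f \<longleftrightarrow>
     (\<forall>x\<in>S. f differentiable (at x)) \<and> (\<forall>v. Ck_on k S (\<lambda>x. frechet_derivative f (at x) v))"

text \<open>Only used for open sets; the derivatives are taken in the ambient space.\<close>

definition smooth_on :: "'a::real_normed_vector set \<Rightarrow> ('a \<Rightarrow> 'b::real_normed_vector) \<Rightarrow> bool" where
  "smooth_on S f \<longleftrightarrow> (\<forall>k. Ck_on k S f)"


section \<open>Smooth manifolds\<close>

text \<open>A chart is a pair \<open>(U, \<phi>)\<close>; the values of \<open>\<phi>\<close> outside \<open>U\<close> are irrelevant.
  The dimension of the manifold is \<open>CARD('n)\<close>.\<close>

type_synonym ('m, 'n) chart = "'m set \<times> ('m \<Rightarrow> real ^ 'n)"

definition coord_range :: "('m, 'n::finite) chart \<Rightarrow> (real ^ 'n) set" where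
  "coord_range c = snd c ` fst c"

definition chart_inv :: "('m, 'n::finite) chart \<Rightarrow> real ^ 'n \<Rightarrow> 'm" where
  "chart_inv c = inv_into (fst c) (snd c)"

definition overlap :: "('m, 'n::finite) chart \<Rightarrow> ('m, 'n) chart \<Rightarrow> (real ^ 'n) set" where
  "overlap c d = snd c ` (fst c \<inter> fst d)"

definition transition :: "('m, 'n::finite) chart \<Rightarrow> ('m, 'n) chart \<Rightarrow> real ^ 'n \<Rightarrow> real ^ 'n" where
  "transition c d = snd d \<circ> chart_inv c"

definition transition_jacobian ::
    "('m, 'n::finite) chart \<Rightarrow> ('m, 'n) chart \<Rightarrow> real ^ 'n \<Rightarrow> real ^ 'n ^ 'n" where
  "transition_jacobian c d x = jacobian (transition c d) (at x)"

definition topological_chart :: "'m topology \<Rightarrow> ('m, 'n::finite) chart \<Rightarrow> bool" where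
  "topological_chart M c \<longleftrightarrow>
     openin M (fst c) \<and> open (coord_range c) \<and>
     homeomorphic_map (subtopology M (fst c)) (top_of_set (coord_range c)) (snd c)"

text \<open>The atlas need not be maximal. All conditions below are imposed in the charts of the given
  atlas only; by the transformation laws they then hold in every compatible chart.\<close>

definition smooth_manifold :: "'m topology \<Rightarrow> ('m, 'n::finite) chart set \<Rightarrow> bool" where
  "smooth_manifold M A \<longleftrightarrow>
     Hausdorff_space M \<and> second_countable M \<and>
     (\<forall>c\<in>A. topological_chart M c) \<and>
     (\<Union>c\<in>A. fst c) = topspace M \<and>
     (\<forall>c\<in>A. \<forall>d\<in>A. smooth_on (overlap c d) (transition c d))"


section \<open>Fields on a manifold\<close>

text \<open>Fields other than scalars are given by their components in each chart of the atlas,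
  as functions of the coordinates \<open>x \<in> coord_range c\<close>, subject to the
  transformation law on overlaps. The Jacobian has entries
  \<open>J $ k $ i = \<partial>x'\<^sup>k / \<partial>x\<^sup>i\<close>, where \<open>x'\<close> are the coordinates of the second chart.\<close>

definition smooth_scalar :: "('m, 'n::finite) chart set \<Rightarrow> ('m \<Rightarrow> real) \<Rightarrow> bool" where
  "smooth_scalar A h \<longleftrightarrow> (\<forall>c\<in>A. smooth_on (coord_range c) (h \<circ> chart_inv c))"

definition one_form ::
    "('m, 'n::finite) chart set \<Rightarrow> (('m, 'n) chart \<Rightarrow> real ^ 'n \<Rightarrow> real ^ 'n) \<Rightarrow> bool" where
  "one_form A b \<longleftrightarrow>
     (\<forall>c\<in>A. smooth_on (coord_range c) (b c)) \<and>
     (\<forall>c\<in>A. \<forall>d\<in>A. \<forall>x\<in>overlap c d.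
        b c x = transpose (transition_jacobian c d x) *v b d (transition c d x))"

definition riemannian_metric ::
    "('m, 'n::finite) chart set \<Rightarrow> (('m, 'n) chart \<Rightarrow> real ^ 'n \<Rightarrow> real ^ 'n ^ 'n) \<Rightarrow> bool" where
  "riemannian_metric A a \<longleftrightarrow>
     (\<forall>c\<in>A. smooth_on (coord_range c) (a c)) \<and>
     (\<forall>c\<in>A. \<forall>x\<in>coord_range c.
        transpose (a c x) = a c x \<and> (\<forall>y. y \<noteq> 0 \<longrightarrow> y \<bullet> (a c x *v y) > 0)) \<and>
     (\<forall>c\<in>A. \<forall>d\<in>A. \<forall>x\<in>overlap c d.
        a c x = transpose (transition_jacobian c d x) ** a d (transition c d x)
                  ** transition_jacobian c d x)"

text \<open>A volume form \<open>\<sigma>(x) dx\<^sup>1 \<dots> dx\<^sup>n\<close> with \<open>\<sigma> > 0\<close> in every chart is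
  a positive density: \<open>\<sigma>\<close> transforms with the absolute value of the Jacobian determinant,
  and the manifold need not be orientable. In an oriented atlas this is the same as
  a positive \<open>n\<close>-form.\<close>

definition volume_form ::
    "('m, 'n::finite) chart set \<Rightarrow> (('m, 'n) chart \<Rightarrow> real ^ 'n \<Rightarrow> real) \<Rightarrow> bool" where
  "volume_form A \<sigma> \<longleftrightarrow>
     (\<forall>c\<in>A. smooth_on (coord_range c) (\<sigma> c)) \<and>
     (\<forall>c\<in>A. \<forall>x\<in>coord_range c. \<sigma> c x > 0) \<and>
     (\<forall>c\<in>A. \<forall>d\<in>A. \<forall>x\<in>overlap c d.
        \<sigma> c x = \<bar>det (transition_jacobian c d x)\<bar> * \<sigma> d (transition c d x))"


section \<open>Sprays in local coordinates\<close>

definition pd :: "'n::finite \<Rightarrow> (real ^ 'n \<Rightarrow> real) \<Rightarrow> real ^ 'n \<Rightarrow> real" where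
  "pd i f x = deriv (\<lambda>t. f (x + t *\<^sub>R axis i 1)) 0"

text \<open>Partial derivatives of a function \<open>f(x, y)\<close> on the tangent bundle of a chart,
  with respect to \<open>x\<^sup>i\<close> and \<open>y\<^sup>i\<close>.\<close>

definition dx :: "'n::finite \<Rightarrow> (real ^ 'n \<Rightarrow> real ^ 'n \<Rightarrow> real) \<Rightarrow> real ^ 'n \<Rightarrow> real ^ 'n \<Rightarrow> real" where
  "dx i f x y = pd i (\<lambda>x'. f x' y) x"

definition dy :: "'n::finite \<Rightarrow> (real ^ 'n \<Rightarrow> real ^ 'n \<Rightarrow> real) \<Rightarrow> real ^ 'n \<Rightarrow> real ^ 'n \<Rightarrow> real" where
  "dy i f x y = pd i (\<lambda>y'. f x y') y"

text \<open>A spray is represented in a chart by its coefficients, \<open>G x y $ i = G\<^sup>i(x, y)\<close>.\<close>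

type_synonym 'n spray = "real ^ 'n \<Rightarrow> real ^ 'n \<Rightarrow> real ^ 'n"

definition riemann_curvature ::
    "'n::finite spray \<Rightarrow> 'n \<Rightarrow> 'n \<Rightarrow> real ^ 'n \<Rightarrow> real ^ 'n \<Rightarrow> real" where
  "riemann_curvature G i k x y =
     (let Gc = (\<lambda>m x y. G x y $ m) in
      2 * dx k (Gc i) x y
      - (\<Sum>j\<in>UNIV. y $ j * dx j (dy k (Gc i)) x y)
      + 2 * (\<Sum>j\<in>UNIV. G x y $ j * dy j (dy k (Gc i)) x y)
      - (\<Sum>s\<in>UNIV. dy s (Gc i) x y * dy k (Gc s) x y))"

definition Ric :: "'n::finite spray \<Rightarrow> real ^ 'n \<Rightarrow> real ^ 'n \<Rightarrow> real" where
  "Ric G x y = (\<Sum>m\<in>UNIV. riemann_curvature G m m x y)"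

definition S_curvature ::
    "'n::finite spray \<Rightarrow> (real ^ 'n \<Rightarrow> real) \<Rightarrow> real ^ 'n \<Rightarrow> real ^ 'n \<Rightarrow> real" where
  "S_curvature G \<sigma> x y =
     (\<Sum>m\<in>UNIV. dy m (\<lambda>x y. G x y $ m) x y)
     - (\<Sum>m\<in>UNIV. y $ m * pd m (\<lambda>x. ln (\<sigma> x)) x)"

definition projective_spray :: "'n::finite spray \<Rightarrow> (real ^ 'n \<Rightarrow> real) \<Rightarrow> 'n spray" where
  "projective_spray G \<sigma> x y = G x y - (S_curvature G \<sigma> x y / (real CARD('n) + 1)) *\<^sub>R y"

definition PRic ::
    "'n::finite spray \<Rightarrow> (real ^ 'n \<Rightarrow> real) \<Rightarrow> real ^ 'n \<Rightarrow> real ^ 'n \<Rightarrow> real" where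
  "PRic G \<sigma> = Ric (projective_spray G \<sigma>)"

definition proj_Ricci_flat_spray ::
    "('m, 'n::finite) chart set \<Rightarrow> (('m, 'n) chart \<Rightarrow> 'n spray) \<Rightarrow> bool" where
  "proj_Ricci_flat_spray A G \<longleftrightarrow>
     (\<exists>\<sigma>. volume_form A \<sigma> \<and>
          (\<forall>c\<in>A. \<forall>x\<in>coord_range c. \<forall>y. y \<noteq> 0 \<longrightarrow> PRic (G c) (\<sigma> c) x y = 0))"


section \<open>Finsler metrics in local coordinates\<close>

definition fundamental_tensor ::
    "(real ^ 'n \<Rightarrow> real ^ 'n \<Rightarrow> real) \<Rightarrow> real ^ 'n \<Rightarrow> real ^ 'n \<Rightarrow> real ^ 'n::finite ^ 'n" where
  "fundamental_tensor F x y = (\<chi> i j. 1/2 * dy j (dy i (\<lambda>x y. (F x y)\<^sup>2)) x y)"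

definition finsler_spray :: "(real ^ 'n::finite \<Rightarrow> real ^ 'n \<Rightarrow> real) \<Rightarrow> 'n spray" where
  "finsler_spray F x y =
     (let F2 = (\<lambda>x y. (F x y)\<^sup>2); ginv = matrix_inv (fundamental_tensor F x y) in
      \<chi> i. 1/4 * (\<Sum>l\<in>UNIV. ginv $ i $ l *
               ((\<Sum>k\<in>UNIV. dy l (dx k F2) x y * y $ k) - dx l F2 x y)))"

definition proj_Ricci_flat ::
    "('m, 'n::finite) chart set \<Rightarrow> (('m, 'n) chart \<Rightarrow> real ^ 'n \<Rightarrow> real ^ 'n \<Rightarrow> real) \<Rightarrow> bool" where
  "proj_Ricci_flat A F \<longleftrightarrow> proj_Ricci_flat_spray A (\<lambda>c. finsler_spray (F c))"


section \<open>Randers metrics\<close>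

text \<open>In this section \<open>a\<close>, \<open>b\<close> and \<open>f\<close> are the components, in one chart, of a Riemannian
  metric, a one-form and a scalar function.\<close>

definition alpha :: "(real ^ 'n \<Rightarrow> real ^ 'n ^ 'n) \<Rightarrow> real ^ 'n::finite \<Rightarrow> real ^ 'n \<Rightarrow> real" where
  "alpha a x y = sqrt (\<Sum>i\<in>UNIV. \<Sum>j\<in>UNIV. a x $ i $ j * y $ i * y $ j)"

definition beta :: "(real ^ 'n \<Rightarrow> real ^ 'n) \<Rightarrow> real ^ 'n::finite \<Rightarrow> real ^ 'n \<Rightarrow> real" where
  "beta b x y = (\<Sum>i\<in>UNIV. b x $ i * y $ i)"

definition upper :: "(real ^ 'n \<Rightarrow> real ^ 'n ^ 'n) \<Rightarrow> real ^ 'n::finite \<Rightarrow> 'n \<Rightarrow> 'n \<Rightarrow> real" where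
  "upper a x i j = matrix_inv (a x) $ i $ j"

definition one_form_norm ::
    "(real ^ 'n \<Rightarrow> real ^ 'n ^ 'n) \<Rightarrow> (real ^ 'n \<Rightarrow> real ^ 'n) \<Rightarrow> real ^ 'n::finite \<Rightarrow> real" where
  "one_form_norm a b x = sqrt (\<Sum>i\<in>UNIV. \<Sum>j\<in>UNIV. upper a x i j * b x $ i * b x $ j)"

text \<open>\<open>christoffel a x i j k\<close> is \<open>\<Gamma>\<^sup>i\<^sub>j\<^sub>k\<close>.\<close>

definition christoffel ::
    "(real ^ 'n \<Rightarrow> real ^ 'n ^ 'n) \<Rightarrow> real ^ 'n::finite \<Rightarrow> 'n \<Rightarrow> 'n \<Rightarrow> 'n \<Rightarrow> real" where
  "christoffel a x i j k =
     1/2 * (\<Sum>l\<in>UNIV. upper a x i l *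
       (pd j (\<lambda>x. a x $ l $ k) x + pd k (\<lambda>x. a x $ l $ j) x - pd l (\<lambda>x. a x $ j $ k) x))"

text \<open>\<open>cov_form a b x i j\<close> is \<open>b\<^sub>i\<^sub>;\<^sub>j\<close>.\<close>

definition cov_form ::
    "(real ^ 'n \<Rightarrow> real ^ 'n ^ 'n) \<Rightarrow> (real ^ 'n \<Rightarrow> real ^ 'n) \<Rightarrow> real ^ 'n::finite \<Rightarrow> 'n \<Rightarrow> 'n \<Rightarrow> real" where
  "cov_form a b x i j =
     pd j (\<lambda>x. b x $ i) x - (\<Sum>k\<in>UNIV. christoffel a x k i j * b x $ k)"

definition s_low ::
    "(real ^ 'n \<Rightarrow> real ^ 'n ^ 'n) \<Rightarrow> (real ^ 'n \<Rightarrow> real ^ 'n) \<Rightarrow> real ^ 'n::finite \<Rightarrow> 'n \<Rightarrow> 'n \<Rightarrow> real" where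
  "s_low a b x i j = 1/2 * (cov_form a b x i j - cov_form a b x j i)"

text \<open>\<open>s_mix a b x i j\<close> is \<open>s\<^sup>i\<^sub>j\<close>, and \<open>cov_s_mix a b x i j m\<close> is \<open>s\<^sup>i\<^sub>j\<^sub>;\<^sub>m\<close>.\<close>

definition s_mix ::
    "(real ^ 'n \<Rightarrow> real ^ 'n ^ 'n) \<Rightarrow> (real ^ 'n \<Rightarrow> real ^ 'n) \<Rightarrow> real ^ 'n::finite \<Rightarrow> 'n \<Rightarrow> 'n \<Rightarrow> real" where
  "s_mix a b x i j = (\<Sum>l\<in>UNIV. upper a x i l * s_low a b x l j)"

definition cov_s_mix ::
    "(real ^ 'n \<Rightarrow> real ^ 'n ^ 'n) \<Rightarrow> (real ^ 'n \<Rightarrow> real ^ 'n) \<Rightarrow> real ^ 'n::finite \<Rightarrow>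
       'n \<Rightarrow> 'n \<Rightarrow> 'n \<Rightarrow> real" where
  "cov_s_mix a b x i j m =
     pd m (\<lambda>x. s_mix a b x i j) x
     + (\<Sum>k\<in>UNIV. christoffel a x i k m * s_mix a b x k j)
     - (\<Sum>k\<in>UNIV. christoffel a x k j m * s_mix a b x i k)"

text \<open>Contractions with \<open>y\<close>: \<open>s\<^sub>0\<^sub>m\<close>, \<open>s\<^sup>m\<^sub>0\<close>, \<open>s\<^sup>m\<^sub>0\<^sub>;\<^sub>m\<close>, \<open>h\<^sub>0\<close> and \<open>h\<^sub>0\<^sub>;\<^sub>0\<close>.\<close>

definition s_low_0 ::
    "(real ^ 'n \<Rightarrow> real ^ 'n ^ 'n) \<Rightarrow> (real ^ 'n \<Rightarrow> real ^ 'n) \<Rightarrow> real ^ 'n::finite \<Rightarrow> real ^ 'n \<Rightarrow> 'n \<Rightarrow> real" where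
  "s_low_0 a b x y m = (\<Sum>i\<in>UNIV. s_low a b x i m * y $ i)"

definition s_up_0 ::
    "(real ^ 'n \<Rightarrow> real ^ 'n ^ 'n) \<Rightarrow> (real ^ 'n \<Rightarrow> real ^ 'n) \<Rightarrow> real ^ 'n::finite \<Rightarrow> real ^ 'n \<Rightarrow> 'n \<Rightarrow> real" where
  "s_up_0 a b x y m = (\<Sum>j\<in>UNIV. s_mix a b x m j * y $ j)"

definition div_s_0 ::
    "(real ^ 'n \<Rightarrow> real ^ 'n ^ 'n) \<Rightarrow> (real ^ 'n \<Rightarrow> real ^ 'n) \<Rightarrow> real ^ 'n::finite \<Rightarrow> real ^ 'n \<Rightarrow> real" where
  "div_s_0 a b x y = (\<Sum>m\<in>UNIV. \<Sum>j\<in>UNIV. cov_s_mix a b x m j m * y $ j)"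

definition grad_0 :: "(real ^ 'n \<Rightarrow> real) \<Rightarrow> real ^ 'n::finite \<Rightarrow> real ^ 'n \<Rightarrow> real" where
  "grad_0 f x y = (\<Sum>m\<in>UNIV. pd m f x * y $ m)"

definition hess_00 ::
    "(real ^ 'n \<Rightarrow> real ^ 'n ^ 'n) \<Rightarrow> (real ^ 'n \<Rightarrow> real) \<Rightarrow> real ^ 'n::finite \<Rightarrow> real ^ 'n \<Rightarrow> real" where
  "hess_00 a f x y =
     (\<Sum>i\<in>UNIV. \<Sum>j\<in>UNIV. cov_form a (\<lambda>x. \<chi> k. pd k f x) x i j * y $ i * y $ j)"

definition randers ::
    "(real ^ 'n \<Rightarrow> real ^ 'n ^ 'n) \<Rightarrow> (real ^ 'n \<Rightarrow> real ^ 'n) \<Rightarrow> real ^ 'n::finite \<Rightarrow> real ^ 'n \<Rightarrow> real" where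
  "randers a b x y = alpha a x y + beta b x y"

end

theory Submission
  imports Defs
begin

text \<open>
  Two sprays that differ by \<open>P y\<close>, with \<open>P\<close> positively homogeneous of degree one, have the same
  projective spray, because the divergence in \<open>y\<close> of \<open>P y\<close> is \<open>(n + 1) P\<close> by Euler's identity.
  The spray of a Randers metric \<open>F = \<alpha> + \<beta>\<close> has the coefficients
  \<open>G\<^sub>\<alpha>\<^sup>i + \<alpha> s\<^sup>i\<^sub>0 + P y\<^sup>i\<close>, where \<open>G\<^sub>\<alpha>\<close> belongs to \<open>\<alpha>\<close>, and \<open>\<alpha> s\<^sup>i\<^sub>0\<close> has divergence
  zero. Hence the projective spray only depends on \<open>\<alpha>\<close>, on the exterior derivative of \<open>\<beta>\<close> and on
  the volume form \<open>\<sigma>\<close>. The latter enters through the function \<open>h\<close> with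
  \<open>(n + 1) h = ln (\<sigma>\<^sub>\<alpha> / \<sigma>)\<close>, where \<open>\<sigma>\<^sub>\<alpha>\<close> is the Riemannian density, and the coefficients of the
  projective spray are \<open>G\<^sub>\<alpha>\<^sup>i + \<alpha> s\<^sup>i\<^sub>0 - h\<^sub>0 y\<^sup>i\<close>. This is
  \<open>projective_spray_randers\<close>, which rests on \<open>finsler_spray_randers\<close>.

  By \<open>Ric_projective\<close>, the Ricci curvature of this spray is the sum of
  \<open>Ric\<^sub>\<alpha> - 2 s\<^sub>0\<^sub>m s\<^sup>m\<^sub>0 - \<alpha>\<^sup>2 s\<^sup>i\<^sub>j s\<^sup>j\<^sub>i + (n - 1) (h\<^sub>0\<^sub>;\<^sub>0 + h\<^sub>0\<^sup>2)\<close>, which is even in \<open>y\<close>, and of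
  \<open>2 \<alpha> (s\<^sup>m\<^sub>0\<^sub>;\<^sub>m - (n - 1) h\<^sub>m s\<^sup>m\<^sub>0)\<close>, which is odd. So it vanishes for all \<open>y\<close> if and only if
  both parts do, and these are the two equations of the theorem
  (\<open>projectively_Ricci_flat_at_iff\<close>).

  Finally, a volume form and the Riemannian density transform by the same factor, so that \<open>h\<close> is a
  function on the manifold; conversely, every smooth \<open>h\<close> comes from the volume form
  \<open>exp (-(n + 1) h) \<sigma>\<^sub>\<alpha>\<close> (\<open>log_density_ratio\<close>, \<open>volume_form_of_function\<close>).
\<close>

section \<open>Closure properties of smooth functions\<close>

lemma frechet_derivative_eqI: "(f has_derivative f') (at x) \<Longrightarrow> frechet_derivative f (at x) v = f' v"
  by (metis frechet_derivative_at)

lemma has_derivative_frechet: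
  "f differentiable (at x) \<Longrightarrow> (f has_derivative (\<lambda>v. frechet_derivative f (at x) v)) (at x)"
  using frechet_derivative_works by blast

lemma Ck_on_cong:
  assumes "open S" and "\<And>x. x \<in> S \<Longrightarrow> f x = g x"
  shows "Ck_on k S f \<longleftrightarrow> Ck_on k S g"
proof -
  have imp: "Ck_on k S g" if "Ck_on k S f" "\<And>x. x \<in> S \<Longrightarrow> f x = g x" for k f g
    using that
  proof (induction k arbitrary: f g)
    case 0
    then show ?case by (simp cong: continuous_on_cong)
  next
    case (Suc k)
    have d: "f differentiable (at x)" if "x \<in> S" for x
      using Suc.prems that by simp
    have hd: "(g has_derivative frechet_derivative f (at x)) (at x)" if "x \<in> S" for x
      using has_derivative_transform_within_open[OF has_derivative_frechet[OF d[OF that]] assms(1) that]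
        Suc.prems(2) by blast
    have "Ck_on k S (\<lambda>x. frechet_derivative g (at x) v)" for v
    proof (rule Suc.IH)
      show "Ck_on k S (\<lambda>x. frechet_derivative f (at x) v)" using Suc.prems by simp
      show "frechet_derivative f (at x) v = frechet_derivative g (at x) v" if "x \<in> S" for x
        using frechet_derivative_eqI[OF hd[OF that]] by simp
    qed
    then show ?case using hd by (auto simp: differentiable_def)
  qed
  show ?thesis using imp[of k f g] imp[of k g f] assms(2) by auto
qed

text \<open>Explicit derivatives make the closure properties below inductions on the order: the derivative of a
  product, inverse, logarithm or exponential is again built from such functions, of one order less.\<close>

lemma Ck_on_SucI:
  assumes "open S" and "\<And>x. x \<in> S \<Longrightarrow> (f has_derivative f' x) (at x)"
    and "\<And>v. Ck_on k S (\<lambda>x. f' x v)"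
  shows "Ck_on (Suc k) S f"
proof -
  have "Ck_on k S (\<lambda>x. frechet_derivative f (at x) v)" for v
    using Ck_on_cong[OF assms(1), of "\<lambda>x. frechet_derivative f (at x) v" "\<lambda>x. f' x v" k]
      assms(2,3) frechet_derivative_eqI by blast
  then show ?thesis using assms(2) by (auto simp: differentiable_def)
qed

lemma Ck_on_SucD:
  assumes "Ck_on (Suc k) S f"
  shows "x \<in> S \<Longrightarrow> (f has_derivative frechet_derivative f (at x)) (at x)"
    and "Ck_on k S (\<lambda>x. frechet_derivative f (at x) v)"
  using assms frechet_derivative_works by auto

lemma Ck_on_Suc_imp: "Ck_on (Suc k) S f \<Longrightarrow> Ck_on k S f"
proof (induction k arbitrary: f)
  case 0
  then show ?case
    by (auto intro!: continuous_at_imp_continuous_on differentiable_imp_continuous_within)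
next
  case (Suc k)
  then show ?case by (metis Ck_on.simps(2))
qed

lemma Ck_on_const: "Ck_on k S (\<lambda>x. c)"
  by (induction k arbitrary: c) auto

lemma Ck_on_add:
  assumes "open S" "Ck_on k S f" "Ck_on k S g"
  shows "Ck_on k S (\<lambda>x. f x + g x)"
  using assms(2,3)
proof (induction k arbitrary: f g)
  case 0
  then show ?case by (auto intro: continuous_intros)
next
  case (Suc k)
  show ?case
    by (rule Ck_on_SucI[OF assms(1)
          has_derivative_add[OF Ck_on_SucD(1)[OF Suc.prems(1)] Ck_on_SucD(1)[OF Suc.prems(2)]]])
      (assumption | rule Suc.IH Ck_on_SucD(2) Suc.prems)+
qed

lemma Ck_on_mult:
  fixes f g :: "'a::real_normed_vector \<Rightarrow> real"
  assumes "open S" "Ck_on k S f" "Ck_on k S g"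
  shows "Ck_on k S (\<lambda>x. f x * g x)"
  using assms(2,3)
proof (induction k arbitrary: f g)
  case 0
  then show ?case by (auto intro: continuous_intros)
next
  case (Suc k)
  show ?case
    by (rule Ck_on_SucI[OF assms(1)
          has_derivative_mult[OF Ck_on_SucD(1)[OF Suc.prems(1)] Ck_on_SucD(1)[OF Suc.prems(2)]]])
      (assumption | rule Suc.IH Ck_on_add[OF assms(1)] Ck_on_SucD(2) Suc.prems
         Ck_on_Suc_imp[OF Suc.prems(1)] Ck_on_Suc_imp[OF Suc.prems(2)])+
qed

lemma Ck_on_linear:
  assumes "open S" "bounded_linear L" "Ck_on k S f"
  shows "Ck_on k S (\<lambda>x. L (f x))"
  using assms(3)
proof (induction k arbitrary: f)
  case 0
  then show ?case
    by (auto intro: continuous_on_compose2[OF linear_continuous_on[OF assms(2)]])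
next
  case (Suc k)
  show ?case
    by (rule Ck_on_SucI[OF assms(1)
          bounded_linear.has_derivative[OF assms(2) Ck_on_SucD(1)[OF Suc.prems]]])
      (assumption | rule Suc.IH Ck_on_SucD(2) Suc.prems)+
qed

lemma Ck_on_inverse:
  fixes f :: "'a::real_normed_vector \<Rightarrow> real"
  assumes "open S" "Ck_on k S f" "\<And>x. x \<in> S \<Longrightarrow> f x \<noteq> 0"
  shows "Ck_on k S (\<lambda>x. inverse (f x))"
  using assms(2)
proof (induction k)
  case 0
  then show ?case using assms(3) by (auto intro: continuous_intros)
next
  case (Suc k)
  have inv: "Ck_on k S (\<lambda>x. inverse (f x))" using Suc.IH Ck_on_Suc_imp[OF Suc.prems] .
  show ?case
  proof (rule Ck_on_SucI[OF assms(1)])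
    show "((\<lambda>x. inverse (f x)) has_derivative
        (\<lambda>v. -1 * (inverse (f x) * frechet_derivative f (at x) v * inverse (f x)))) (at x)"
      if "x \<in> S" for x
      using Deriv.has_derivative_inverse[OF assms(3)[OF that] Ck_on_SucD(1)[OF Suc.prems that]] by simp
    show "Ck_on k S (\<lambda>x. -1 * (inverse (f x) * frechet_derivative f (at x) v * inverse (f x)))" for v
      by (intro Ck_on_mult assms(1) inv Ck_on_SucD(2) Suc.prems Ck_on_const)
  qed
qed

lemma Ck_on_ln:
  fixes f :: "'a::real_normed_vector \<Rightarrow> real"
  assumes "open S" "Ck_on k S f" "\<And>x. x \<in> S \<Longrightarrow> f x > 0"
  shows "Ck_on k S (\<lambda>x. ln (f x))"
proof (cases k)
  case 0
  then show ?thesis using assms by (auto intro!: continuous_intros simp: less_le)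
next
  case (Suc m)
  have f: "Ck_on (Suc m) S f" using assms(2) Suc by simp
  have "Ck_on (Suc m) S (\<lambda>x. ln (f x))"
  proof (rule Ck_on_SucI[OF assms(1)])
    show "((\<lambda>x. ln (f x)) has_derivative
        (\<lambda>v. frechet_derivative f (at x) v * inverse (f x))) (at x)" if "x \<in> S" for x
      using has_derivative_ln[OF assms(3)[OF that] Ck_on_SucD(1)[OF f that]] .
    show "Ck_on m S (\<lambda>x. frechet_derivative f (at x) v * inverse (f x))" for v
      using assms(3) by (intro Ck_on_mult Ck_on_inverse assms(1) Ck_on_SucD(2) f Ck_on_Suc_imp[OF f]) force
  qed
  then show ?thesis using Suc by simp
qed

lemma Ck_on_exp:
  fixes f :: "'a::real_normed_vector \<Rightarrow> real"
  assumes "open S" "Ck_on k S f"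
  shows "Ck_on k S (\<lambda>x. exp (f x))"
  using assms(2)
proof (induction k)
  case 0
  then show ?case by (auto intro: continuous_intros)
next
  case (Suc k)
  have e: "Ck_on k S (\<lambda>x. exp (f x))" using Suc.IH Ck_on_Suc_imp[OF Suc.prems] .
  show ?case
  proof (rule Ck_on_SucI[OF assms(1)])
    show "((\<lambda>x. exp (f x)) has_derivative (\<lambda>v. frechet_derivative f (at x) v * exp (f x))) (at x)"
      if "x \<in> S" for x
      using has_derivative_exp[OF Ck_on_SucD(1)[OF Suc.prems that]] .
    show "Ck_on k S (\<lambda>x. frechet_derivative f (at x) v * exp (f x))" for v
      by (intro Ck_on_mult assms(1) e Ck_on_SucD(2) Suc.prems)
  qed
qed

named_theorems smooth_intros

lemma smooth_on_cong:
  assumes "open S" and "\<And>x. x \<in> S \<Longrightarrow> f x = g x"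
  shows "smooth_on S f \<longleftrightarrow> smooth_on S g"
  unfolding smooth_on_def using Ck_on_cong[OF assms] by auto

lemma smooth_on_differentiable: "smooth_on S f \<Longrightarrow> x \<in> S \<Longrightarrow> f differentiable (at x)"
  unfolding smooth_on_def by (metis Ck_on.simps(2))

lemma smooth_on_frechet_derivative:
  "smooth_on S f \<Longrightarrow> smooth_on S (\<lambda>x. frechet_derivative f (at x) v)"
  unfolding smooth_on_def by (metis Ck_on.simps(2))

lemma smooth_on_const [smooth_intros]: "smooth_on S (\<lambda>x. c)"
  unfolding smooth_on_def by (simp add: Ck_on_const)

lemma smooth_on_add [smooth_intros]:
  "open S \<Longrightarrow> smooth_on S f \<Longrightarrow> smooth_on S g \<Longrightarrow> smooth_on S (\<lambda>x. f x + g x)"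
  unfolding smooth_on_def by (simp add: Ck_on_add)

lemma smooth_on_mult [smooth_intros]:
  fixes f g :: "'a::real_normed_vector \<Rightarrow> real"
  shows "open S \<Longrightarrow> smooth_on S f \<Longrightarrow> smooth_on S g \<Longrightarrow> smooth_on S (\<lambda>x. f x * g x)"
  unfolding smooth_on_def by (simp add: Ck_on_mult)

lemma smooth_on_diff [smooth_intros]:
  fixes f g :: "'a::real_normed_vector \<Rightarrow> real"
  shows "open S \<Longrightarrow> smooth_on S f \<Longrightarrow> smooth_on S g \<Longrightarrow> smooth_on S (\<lambda>x. f x - g x)"
  using smooth_on_add[of S f "\<lambda>x. -1 * g x"] smooth_on_mult[of S "\<lambda>x. -1" g] smooth_on_const
  by (simp only: mult_minus1 add_uminus_conv_diff) blast

lemma smooth_on_sum [smooth_intros]: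
  "open S \<Longrightarrow> (\<And>i. i \<in> I \<Longrightarrow> smooth_on S (f i)) \<Longrightarrow> smooth_on S (\<lambda>x. \<Sum>i\<in>I. f i x)"
  by (induction I rule: infinite_finite_induct) (auto intro: smooth_intros)

lemma smooth_on_prod [smooth_intros]:
  fixes f :: "'i \<Rightarrow> 'a::real_normed_vector \<Rightarrow> real"
  shows "open S \<Longrightarrow> (\<And>i. i \<in> I \<Longrightarrow> smooth_on S (f i)) \<Longrightarrow> smooth_on S (\<lambda>x. \<Prod>i\<in>I. f i x)"
  by (induction I rule: infinite_finite_induct) (auto intro: smooth_intros)

lemma smooth_on_power [smooth_intros]:
  fixes f :: "'a::real_normed_vector \<Rightarrow> real"
  shows "open S \<Longrightarrow> smooth_on S f \<Longrightarrow> smooth_on S (\<lambda>x. f x ^ k)"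
  by (induction k) (auto intro: smooth_intros)

lemma smooth_on_divide [smooth_intros]:
  fixes f g :: "'a::real_normed_vector \<Rightarrow> real"
  shows "open S \<Longrightarrow> smooth_on S f \<Longrightarrow> smooth_on S g \<Longrightarrow> (\<And>x. x \<in> S \<Longrightarrow> g x \<noteq> 0)
    \<Longrightarrow> smooth_on S (\<lambda>x. f x / g x)"
  unfolding smooth_on_def divide_inverse by (simp add: Ck_on_mult Ck_on_inverse)

lemma smooth_on_ln [smooth_intros]:
  fixes f :: "'a::real_normed_vector \<Rightarrow> real"
  shows "open S \<Longrightarrow> smooth_on S f \<Longrightarrow> (\<And>x. x \<in> S \<Longrightarrow> f x > 0) \<Longrightarrow> smooth_on S (\<lambda>x. ln (f x))"
  unfolding smooth_on_def by (simp add: Ck_on_ln)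

lemma smooth_on_exp [smooth_intros]:
  fixes f :: "'a::real_normed_vector \<Rightarrow> real"
  shows "open S \<Longrightarrow> smooth_on S f \<Longrightarrow> smooth_on S (\<lambda>x. exp (f x))"
  unfolding smooth_on_def by (simp add: Ck_on_exp)

lemma smooth_on_component:
  fixes f :: "'a::real_normed_vector \<Rightarrow> ('b::real_normed_vector) ^ 'n::finite"
  shows "open S \<Longrightarrow> smooth_on S f \<Longrightarrow> smooth_on S (\<lambda>x. f x $ i)"
  unfolding smooth_on_def by (simp add: Ck_on_linear[OF _ bounded_linear_vec_nth])

lemma smooth_on_det [smooth_intros]:
  fixes f :: "'a::real_normed_vector \<Rightarrow> real ^ 'n ^ 'n::finite"
  shows "open S \<Longrightarrow> (\<And>i j. smooth_on S (\<lambda>x. f x $ i $ j)) \<Longrightarrow> smooth_on S (\<lambda>x. det (f x))"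
  unfolding det_def by (auto intro!: smooth_intros)

section \<open>The inverse of a matrix and the derivative of its determinant\<close>

lemma matrix_inv_inverse:
  fixes A :: "real ^ 'n ^ 'n::finite"
  assumes "det A \<noteq> 0"
  shows "A ** matrix_inv A = mat 1" "matrix_inv A ** A = mat 1"
proof -
  have "\<exists>B. A ** B = mat 1 \<and> B ** A = mat 1"
    using assms invertible_det_nz unfolding invertible_def by blast
  then have "A ** matrix_inv A = mat 1 \<and> matrix_inv A ** A = mat 1"
    unfolding matrix_inv_def by (rule someI_ex)
  then show "A ** matrix_inv A = mat 1" "matrix_inv A ** A = mat 1" by auto
qed

text \<open>Cramer's rule exhibits the entries of the inverse as quotients of polynomials, hence as smooth functions.\<close>

lemma matrix_inv_cramer:
  fixes A :: "real ^ 'n ^ 'n::finite"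
  assumes "det A \<noteq> 0"
  shows "matrix_inv A $ k $ l = det (\<chi> i j. if j = k then axis l 1 $ i else A $ i $ j) / det A"
proof -
  have "A *v (matrix_inv A *v axis l 1) = axis l 1"
    by (simp add: matrix_vector_mul_assoc matrix_inv_inverse[OF assms])
  then have "(matrix_inv A *v axis l 1) $ k =
      det (\<chi> i j. if j = k then axis l 1 $ i else A $ i $ j) / det A"
    using cramer[OF assms] by simp
  moreover have "(matrix_inv A *v axis l 1) $ k = matrix_inv A $ k $ l"
    by (simp add: matrix_vector_mult_basis column_def)
  ultimately show ?thesis by simp
qed

lemma smooth_on_matrix_inv:
  fixes f :: "'a::real_normed_vector \<Rightarrow> real ^ 'n ^ 'n::finite"
  assumes "open S" "\<And>i j. smooth_on S (\<lambda>x. f x $ i $ j)" "\<And>x. x \<in> S \<Longrightarrow> det (f x) \<noteq> 0"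
  shows "smooth_on S (\<lambda>x. matrix_inv (f x) $ k $ l)"
proof -
  have *: "smooth_on S (\<lambda>x. (\<chi> i j. if j = k then axis l 1 $ i else f x $ i $ j) $ i $ j)" for i j
    using assms(2) by (cases "j = k") (auto intro: smooth_intros)
  have "smooth_on S (\<lambda>x. det (\<chi> i j. if j = k then axis l 1 $ i else f x $ i $ j) / det (f x))"
    using assms * by (intro smooth_intros) auto
  then show ?thesis
    by (subst smooth_on_cong[OF assms(1) matrix_inv_cramer[OF assms(3)]])
qed

lemma has_derivative_det_rows:
  fixes f :: "real \<Rightarrow> real ^ 'n ^ 'n::finite"
  assumes "\<And>i j. ((\<lambda>t. f t $ i $ j) has_real_derivative B $ i $ j) (at x)"
  shows "((\<lambda>t. det (f t)) has_real_derivative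
           (\<Sum>k\<in>UNIV. det (\<chi> i. if i = k then B $ i else f x $ i))) (at x)"
proof -
  have term_derivative: "((\<lambda>t. of_int (sign p) * (\<Prod>i\<in>UNIV. f t $ i $ p i)) has_real_derivative
      of_int (sign p) * (\<Sum>k\<in>UNIV. B $ k $ p k * (\<Prod>i\<in>UNIV - {k}. f x $ i $ p i))) (at x)" for p
    by (intro DERIV_cmult has_field_derivative_prod) (rule assms)
  have row: "det (\<chi> i. if i = k then B $ i else f x $ i) =
      (\<Sum>p | p permutes UNIV. of_int (sign p) * (B $ k $ p k * (\<Prod>i\<in>UNIV - {k}. f x $ i $ p i)))" for k
    unfolding det_def by (intro sum.cong refl arg_cong2[of _ _ _ _ "(*)"])
      (simp add: prod.remove[of UNIV k])
  show ?thesis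
    unfolding row
    apply (subst sum.swap)
    unfolding det_def sum_distrib_left[symmetric]
    by (intro DERIV_sum term_derivative)
qed

text \<open>By the product rule, the derivative of a determinant is a sum of determinants with one row
  differentiated. Writing the derivative as \<open>B = C A\<close> with \<open>C = B A\<^sup>-\<^sup>1\<close>, its row \<open>k\<close> is a
  combination of the rows of \<open>A\<close> in which only the coefficient \<open>C\<^sub>k\<^sub>k\<close> of row \<open>k\<close> contributes.\<close>

lemma Jacobi_formula:
  fixes f :: "real \<Rightarrow> real ^ 'n ^ 'n::finite"
  assumes "\<And>i j. ((\<lambda>t. f t $ i $ j) has_real_derivative B $ i $ j) (at x)" and "det (f x) \<noteq> 0"
  shows "((\<lambda>t. det (f t)) has_real_derivative
           det (f x) * (\<Sum>i\<in>UNIV. \<Sum>l\<in>UNIV. B $ i $ l * matrix_inv (f x) $ l $ i)) (at x)"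
proof -
  define C where "C = B ** matrix_inv (f x)"
  have "B = C ** f x"
    unfolding C_def by (simp add: matrix_mul_assoc[symmetric] matrix_inv_inverse[OF assms(2)])
  then have "B $ k = (\<Sum>l\<in>UNIV. C $ k $ l *s row l (f x))" for k
    by (simp add: vec_eq_iff matrix_matrix_mult_def row_def)
  then have "det (\<chi> i. if i = k then B $ i else f x $ i) =
      det (\<chi> i. if i = k then \<Sum>l\<in>UNIV. C $ k $ l *s row l (f x) else row i (f x))" for k
    by (intro arg_cong[of _ _ det]) (simp add: vec_eq_iff row_def)
  then have "det (\<chi> i. if i = k then B $ i else f x $ i) = C $ k $ k * det (f x)" for k
    using cramer_lemma_transpose[of k "C $ k" "f x"] by simp
  then have "(\<Sum>k\<in>UNIV. det (\<chi> i. if i = k then B $ i else f x $ i)) =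
      det (f x) * (\<Sum>i\<in>UNIV. \<Sum>l\<in>UNIV. B $ i $ l * matrix_inv (f x) $ l $ i)"
    by (simp add: C_def matrix_matrix_mult_def sum_distrib_left mult.commute)
  then show ?thesis using has_derivative_det_rows[OF assms(1)] by simp
qed

section \<open>Partial derivatives\<close>

text \<open>As \<^const>\<open>pd\<close> has an unspecified value where the derivative does not exist, rules of differentiation are
  stated for a relation that includes the existence.\<close>

definition has_pd :: "'n::finite \<Rightarrow> (real ^ 'n \<Rightarrow> real) \<Rightarrow> real \<Rightarrow> real ^ 'n \<Rightarrow> bool" where
  "has_pd i f D x \<longleftrightarrow> ((\<lambda>t. f (x + t *\<^sub>R axis i 1)) has_real_derivative D) (at 0)"

lemma has_pd_imp_pd: "has_pd i f D x \<Longrightarrow> pd i f x = D"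
  unfolding has_pd_def pd_def by (rule DERIV_imp_deriv)

lemma has_pd_unique: "has_pd i f D x \<Longrightarrow> has_pd i f E x \<Longrightarrow> D = E"
  unfolding has_pd_def by (rule DERIV_unique)

lemma has_pd_eq: "has_pd i f D x \<Longrightarrow> D = E \<Longrightarrow> has_pd i f E x"
  by simp

lemma has_derivative_imp_has_pd:
  assumes "(f has_derivative f') (at x)"
  shows "has_pd i f (f' (axis i 1)) x"
proof -
  have "((\<lambda>t. x + t *\<^sub>R axis i 1) has_derivative (\<lambda>t. t *\<^sub>R axis i 1)) (at 0)"
    by (auto intro!: derivative_eq_intros)
  then have "((\<lambda>t. f (x + t *\<^sub>R axis i 1)) has_derivative (\<lambda>t. f' (t *\<^sub>R axis i 1))) (at 0)"
    by (rule has_derivative_compose) (simp add: assms)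
  then show ?thesis
    unfolding has_pd_def has_field_derivative_def
    using linear_cmul[OF has_derivative_linear[OF assms]] by (simp add: mult_commute_abs)
qed

lemma pd_frechet_derivative:
  assumes "f differentiable (at x)"
  shows "pd i f x = frechet_derivative f (at x) (axis i 1)"
  using has_derivative_imp_has_pd[where f' = "frechet_derivative f (at x)"] assms
    frechet_derivative_works has_pd_imp_pd by blast

lemma differentiable_has_pd:
  assumes "f differentiable (at x)"
  shows "has_pd i f (pd i f x) x"
  using has_derivative_imp_has_pd[where f' = "frechet_derivative f (at x)"] assms
    frechet_derivative_works pd_frechet_derivative[OF assms] by metis

named_theorems pd_intros

lemma has_pd_const [pd_intros]: "has_pd i (\<lambda>x. c) 0 x"
  unfolding has_pd_def by simp

lemma has_pd_coordinate [pd_intros]: "has_pd i (\<lambda>x. x $ j) (if i = j then 1 else 0) x"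
  unfolding has_pd_def by (auto intro!: derivative_eq_intros simp: axis_def)

lemma has_pd_add [pd_intros]:
  "has_pd i f D x \<Longrightarrow> has_pd i g E x \<Longrightarrow> has_pd i (\<lambda>x. f x + g x) (D + E) x"
  unfolding has_pd_def by (rule DERIV_add)

lemma has_pd_diff [pd_intros]:
  "has_pd i f D x \<Longrightarrow> has_pd i g E x \<Longrightarrow> has_pd i (\<lambda>x. f x - g x) (D - E) x"
  unfolding has_pd_def by (rule DERIV_diff)

lemma has_pd_mult [pd_intros]:
  "has_pd i f D x \<Longrightarrow> has_pd i g E x \<Longrightarrow> has_pd i (\<lambda>x. f x * g x) (D * g x + f x * E) x"
  unfolding has_pd_def by (auto intro!: derivative_eq_intros)

lemma has_pd_sum [pd_intros]:
  "(\<And>k. k \<in> K \<Longrightarrow> has_pd i (f k) (D k) x) \<Longrightarrow> has_pd i (\<lambda>x. \<Sum>k\<in>K. f k x) (\<Sum>k\<in>K. D k) x"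
  unfolding has_pd_def by (rule DERIV_sum)

lemma has_pd_divide [pd_intros]:
  "has_pd i f D x \<Longrightarrow> has_pd i g E x \<Longrightarrow> g x \<noteq> 0
    \<Longrightarrow> has_pd i (\<lambda>x. f x / g x) ((D * g x - f x * E) / (g x)\<^sup>2) x"
  unfolding has_pd_def by (auto intro!: derivative_eq_intros simp: power2_eq_square)

lemma has_pd_power2 [pd_intros]:
  "has_pd i f D x \<Longrightarrow> has_pd i (\<lambda>x. (f x)\<^sup>2) (2 * f x * D) x"
  unfolding has_pd_def by (auto intro!: derivative_eq_intros)

lemma has_pd_sqrt [pd_intros]:
  "has_pd i f D x \<Longrightarrow> f x > 0 \<Longrightarrow> has_pd i (\<lambda>x. sqrt (f x)) (D / (2 * sqrt (f x))) x"
  unfolding has_pd_def by (auto intro!: derivative_eq_intros simp: divide_simps)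

lemma has_pd_ln [pd_intros]:
  "has_pd i f D x \<Longrightarrow> f x > 0 \<Longrightarrow> has_pd i (\<lambda>x. ln (f x)) (D / f x) x"
  unfolding has_pd_def by (auto intro!: derivative_eq_intros simp: divide_simps)

lemma has_pd_cong:
  assumes "open U" "x \<in> U" "\<And>x. x \<in> U \<Longrightarrow> f x = g x" "has_pd i f D x"
  shows "has_pd i g D x"
proof -
  have "open ((\<lambda>t. x + t *\<^sub>R axis i 1) -` U)"
    by (intro continuous_open_vimage assms(1) continuous_intros)
  then show ?thesis
    using assms(2-4) unfolding has_pd_def
    by (elim has_field_derivative_transform_within_open) auto
qed

lemma pd_cong:
  assumes "open U" "x \<in> U" "\<And>x. x \<in> U \<Longrightarrow> f x = g x"
  shows "pd i f x = pd i g x"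
proof -
  have "open ((\<lambda>t. x + t *\<^sub>R axis i 1) -` U)"
    by (intro continuous_open_vimage assms(1) continuous_intros)
  then have "\<forall>\<^sub>F t in nhds 0. t \<in> (\<lambda>t. x + t *\<^sub>R axis i 1) -` U"
    using assms(2) by (intro eventually_nhds_in_open) auto
  then have "\<forall>\<^sub>F t in nhds 0. f (x + t *\<^sub>R axis i 1) = g (x + t *\<^sub>R axis i 1)"
    by eventually_elim (use assms(3) in auto)
  then show ?thesis unfolding pd_def by (intro deriv_cong_ev) auto
qed

lemma smooth_on_has_pd: "smooth_on S f \<Longrightarrow> x \<in> S \<Longrightarrow> has_pd i f (pd i f x) x"
  by (intro differentiable_has_pd smooth_on_differentiable)

lemma smooth_on_pd:
  assumes "open S" "smooth_on S f"
  shows "smooth_on S (pd i f)"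
proof -
  have "smooth_on S (\<lambda>x. frechet_derivative f (at x) (axis i 1))"
    using assms(2) by (rule smooth_on_frechet_derivative)
  moreover have "frechet_derivative f (at x) (axis i 1) = pd i f x" if "x \<in> S" for x
    using pd_frechet_derivative[OF smooth_on_differentiable[OF assms(2) that]] by simp
  ultimately show ?thesis
    using smooth_on_cong[OF assms(1), of "\<lambda>x. frechet_derivative f (at x) (axis i 1)" "pd i f"]
    by simp
qed

text \<open>Both sides are the derivative of \<open>t \<mapsto> f(t y)\<close> at \<open>t = 1\<close>.\<close>

lemma Euler_homogeneous:
  fixes f :: "real ^ 'n::finite \<Rightarrow> real"
  assumes "f differentiable (at y)" and "\<And>t. t > 0 \<Longrightarrow> f (t *\<^sub>R y) = t * f y"
  shows "(\<Sum>m\<in>UNIV. pd m f y * y $ m) = f y"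
proof -
  obtain L where L: "(f has_derivative L) (at y)"
    using assms(1) unfolding differentiable_def by blast
  have pd: "pd m f y = L (axis m 1)" for m
    using has_pd_imp_pd[OF has_derivative_imp_has_pd[OF L]] .
  have "((\<lambda>t. t *\<^sub>R y) has_derivative (\<lambda>t. t *\<^sub>R y)) (at 1)"
    by (auto intro!: derivative_eq_intros)
  then have "((\<lambda>t. f (t *\<^sub>R y)) has_derivative (\<lambda>t. L (t *\<^sub>R y))) (at 1)"
    by (rule has_derivative_compose) (simp add: L)
  then have "((\<lambda>t. f (t *\<^sub>R y)) has_real_derivative L y) (at 1)"
    unfolding has_field_derivative_def
    using linear_cmul[OF has_derivative_linear[OF L]] by (simp add: mult_commute_abs)
  then have "((\<lambda>t. t * f y) has_real_derivative L y) (at 1)"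
    by (rule has_field_derivative_transform_within_open[where S = "{0<..}"]) (auto simp: assms(2))
  moreover have "((\<lambda>t. t * f y) has_real_derivative f y) (at 1)"
    by (auto intro!: derivative_eq_intros)
  ultimately have "L y = f y" by (rule DERIV_unique)
  moreover have "L y = L (\<Sum>m\<in>UNIV. y $ m *\<^sub>R axis m 1)"
    by (simp add: scalar_mult_eq_scaleR[symmetric] basis_expansion)
  ultimately show ?thesis
    by (simp add: linear_sum[OF has_derivative_linear[OF L]]
        linear_cmul[OF has_derivative_linear[OF L]] pd mult.commute)
qed

section \<open>The Ricci curvature in terms of the divergence\<close>

text \<open>In the trace of the Riemann curvature, second derivatives of the spray coefficients enter only through
  the divergence in \<open>y\<close>, which is linear in \<open>y\<close> for every spray considered here. The coefficients
  may be replaced by an expression \<open>K\<close> that agrees with them near \<open>x\<close> and \<open>y\<close>: formulas in a chart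
  hold over the chart domain only, and those that involve \<open>\<alpha>\<close> are differentiable off the zero section
  only.\<close>

lemma Ric_of_linear_divergence:
  fixes G :: "'n::finite spray"
  assumes U: "open U" "x \<in> U" and V: "open V" "y \<in> V"
    and GK: "\<And>x y m. x \<in> U \<Longrightarrow> y \<in> V \<Longrightarrow> G x y $ m = K m x y"
    and N: "\<And>x y m s. x \<in> U \<Longrightarrow> y \<in> V \<Longrightarrow> has_pd s (\<lambda>y. K m x y) (N m s x y) y"
    and E: "\<And>m. has_pd m (\<lambda>x. K m x y) (E m) x"
    and Nx: "\<And>m j. \<exists>D. has_pd j (\<lambda>x. N m m x y) D x"
    and Ny: "\<And>m j. \<exists>D. has_pd j (\<lambda>y. N m m x y) D y"
    and trace: "\<And>x y. x \<in> U \<Longrightarrow> y \<in> V \<Longrightarrow> (\<Sum>m\<in>UNIV. N m m x y) = (\<Sum>k\<in>UNIV. \<tau> k x * y $ k)"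
    and \<tau>: "\<And>j k. has_pd j (\<tau> k) (\<tau>' j k) x"
  shows "Ric G x y = 2 * (\<Sum>m\<in>UNIV. E m) - (\<Sum>j\<in>UNIV. y $ j * (\<Sum>k\<in>UNIV. \<tau>' j k * y $ k))
     + 2 * (\<Sum>j\<in>UNIV. K j x y * \<tau> j x) - (\<Sum>m\<in>UNIV. \<Sum>s\<in>UNIV. N m s x y * N s m x y)"
proof -
  have dyG: "dy s (\<lambda>x y. G x y $ m) x' y' = N m s x' y'" if "x' \<in> U" "y' \<in> V" for m s x' y'
    unfolding dy_def
    using has_pd_imp_pd[OF N[OF that]] pd_cong[OF V(1) that(2) GK[OF that(1)]] by simp
  have dxG: "dx m (\<lambda>x y. G x y $ m) x y = E m" for m
    unfolding dx_def
    using has_pd_imp_pd[OF E] pd_cong[OF U GK[OF _ V(2)]] by simp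
  have dxN: "dx j (dy m (\<lambda>x y. G x y $ m)) x y = pd j (\<lambda>x. N m m x y) x" for j m
    unfolding dx_def by (rule pd_cong[OF U]) (simp add: dyG V)
  have dyN: "dy j (dy m (\<lambda>x y. G x y $ m)) x y = pd j (\<lambda>y. N m m x y) y" for j m
    unfolding dy_def[of j] by (rule pd_cong[OF V]) (simp add: dyG U)
  have Nx': "has_pd j (\<lambda>x. N m m x y) (pd j (\<lambda>x. N m m x y) x) x" for j m
    using Nx[of j m] has_pd_imp_pd by fast
  have Ny': "has_pd j (\<lambda>y. N m m x y) (pd j (\<lambda>y. N m m x y) y) y" for j m
    using Ny[of j m] has_pd_imp_pd by fast
  have sum_x: "(\<Sum>m\<in>UNIV. pd j (\<lambda>x. N m m x y) x) = (\<Sum>k\<in>UNIV. \<tau>' j k * y $ k)" for j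
  proof -
    have "has_pd j (\<lambda>x. \<Sum>k\<in>UNIV. \<tau> k x * y $ k) (\<Sum>k\<in>UNIV. \<tau>' j k * y $ k + \<tau> k x * 0) x"
      by (intro pd_intros \<tau>)
    then have "has_pd j (\<lambda>x. \<Sum>m\<in>UNIV. N m m x y) (\<Sum>k\<in>UNIV. \<tau>' j k * y $ k + \<tau> k x * 0) x"
      by (rule has_pd_cong[OF U, rotated]) (simp add: trace V)
    moreover have "has_pd j (\<lambda>x. \<Sum>m\<in>UNIV. N m m x y) (\<Sum>m\<in>UNIV. pd j (\<lambda>x. N m m x y) x) x"
      by (intro pd_intros Nx')
    ultimately have "(\<Sum>k\<in>UNIV. \<tau>' j k * y $ k + \<tau> k x * 0) = (\<Sum>m\<in>UNIV. pd j (\<lambda>x. N m m x y) x)"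
      by (rule has_pd_unique)
    then show ?thesis by simp
  qed
  have sum_y: "(\<Sum>m\<in>UNIV. pd j (\<lambda>y. N m m x y) y) = \<tau> j x" for j
  proof -
    have "has_pd j (\<lambda>y. \<Sum>k\<in>UNIV. \<tau> k x * y $ k)
        (\<Sum>k\<in>UNIV. 0 * y $ k + \<tau> k x * (if j = k then 1 else 0)) y"
      by (intro pd_intros)
    then have "has_pd j (\<lambda>y. \<Sum>m\<in>UNIV. N m m x y)
        (\<Sum>k\<in>UNIV. 0 * y $ k + \<tau> k x * (if j = k then 1 else 0)) y"
      by (rule has_pd_cong[OF V, rotated]) (simp add: trace U)
    moreover have "has_pd j (\<lambda>y. \<Sum>m\<in>UNIV. N m m x y) (\<Sum>m\<in>UNIV. pd j (\<lambda>y. N m m x y) y) y"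
      by (intro pd_intros Ny')
    ultimately have "(\<Sum>k\<in>UNIV. 0 * y $ k + \<tau> k x * (if j = k then 1 else 0)) =
        (\<Sum>m\<in>UNIV. pd j (\<lambda>y. N m m x y) y)"
      by (rule has_pd_unique)
    then show ?thesis by (simp add: mult_delta_right)
  qed
  have "Ric G x y = 2 * (\<Sum>m\<in>UNIV. E m)
      - (\<Sum>m\<in>UNIV. \<Sum>j\<in>UNIV. y $ j * pd j (\<lambda>x. N m m x y) x)
      + 2 * (\<Sum>m\<in>UNIV. \<Sum>j\<in>UNIV. K j x y * pd j (\<lambda>y. N m m x y) y)
      - (\<Sum>m\<in>UNIV. \<Sum>s\<in>UNIV. N m s x y * N s m x y)"
    unfolding Ric_def riemann_curvature_def Let_def dxG dxN dyN
    by (simp add: dyG U V GK sum.distrib sum_subtractf sum_distrib_left)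
  also have "(\<Sum>m\<in>UNIV. \<Sum>j\<in>UNIV. y $ j * pd j (\<lambda>x. N m m x y) x) =
      (\<Sum>j\<in>UNIV. y $ j * (\<Sum>k\<in>UNIV. \<tau>' j k * y $ k))"
    by (subst sum.swap) (simp add: sum_distrib_left[symmetric] sum_x)
  also have "(\<Sum>m\<in>UNIV. \<Sum>j\<in>UNIV. K j x y * pd j (\<lambda>y. N m m x y) y) =
      (\<Sum>j\<in>UNIV. K j x y * \<tau> j x)"
    by (subst sum.swap) (simp add: sum_distrib_left[symmetric] sum_y)
  finally show ?thesis .
qed

section \<open>Riemannian metrics in a chart\<close>

definition lower :: "(real ^ 'n \<Rightarrow> real ^ 'n ^ 'n) \<Rightarrow> real ^ 'n::finite \<Rightarrow> real ^ 'n \<Rightarrow> 'n \<Rightarrow> real" where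
  "lower a x y l = (\<Sum>j\<in>UNIV. a x $ l $ j * y $ j)"

definition sqnorm :: "(real ^ 'n \<Rightarrow> real ^ 'n ^ 'n) \<Rightarrow> real ^ 'n::finite \<Rightarrow> real ^ 'n \<Rightarrow> real" where
  "sqnorm a x y = (\<Sum>i\<in>UNIV. \<Sum>j\<in>UNIV. a x $ i $ j * y $ i * y $ j)"

definition dmetric :: "(real ^ 'n \<Rightarrow> real ^ 'n ^ 'n) \<Rightarrow> real ^ 'n::finite \<Rightarrow> 'n \<Rightarrow> 'n \<Rightarrow> 'n \<Rightarrow> real" where
  "dmetric a x k i j = pd k (\<lambda>x. a x $ i $ j) x"

definition dsqnorm :: "(real ^ 'n \<Rightarrow> real ^ 'n ^ 'n) \<Rightarrow> real ^ 'n::finite \<Rightarrow> real ^ 'n \<Rightarrow> 'n \<Rightarrow> real" where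
  "dsqnorm a x y k = (\<Sum>i\<in>UNIV. \<Sum>j\<in>UNIV. dmetric a x k i j * y $ i * y $ j)"

text \<open>This is the nonlinear connection \<open>\<Gamma>\<^sup>i\<^sub>s\<^sub>0\<close>; contracting once more with \<open>y\<close> gives \<open>\<Gamma>\<^sup>i\<^sub>0\<^sub>0\<close>, twice the
  geodesic coefficient, below.\<close>

definition conn :: "(real ^ 'n \<Rightarrow> real ^ 'n ^ 'n) \<Rightarrow> real ^ 'n::finite \<Rightarrow> real ^ 'n \<Rightarrow> 'n \<Rightarrow> 'n \<Rightarrow> real" where
  "conn a x y i s = (\<Sum>k\<in>UNIV. christoffel a x i s k * y $ k)"

definition geo :: "(real ^ 'n \<Rightarrow> real ^ 'n ^ 'n) \<Rightarrow> real ^ 'n::finite \<Rightarrow> real ^ 'n \<Rightarrow> 'n \<Rightarrow> real" where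
  "geo a x y i = (\<Sum>s\<in>UNIV. conn a x y i s * y $ s)"

lemma alpha_eq: "alpha a x y = sqrt (sqnorm a x y)"
  by (simp add: alpha_def sqnorm_def)

lemma sqnorm_lower: "sqnorm a x y = (\<Sum>i\<in>UNIV. lower a x y i * y $ i)"
  unfolding sqnorm_def lower_def by (simp add: sum_distrib_left sum_distrib_right mult_ac)

lemma sqnorm_inner: "sqnorm a x y = y \<bullet> (a x *v y)"
  unfolding sqnorm_def inner_vec_def matrix_vector_mult_def
  by (simp add: sum_distrib_left mult_ac)

text \<open>The defining formula inverts the fundamental tensor; a spray is more easily recognised by the
  linear system that its coefficients solve.\<close>

lemma finsler_spray_eqI:
  assumes "det (fundamental_tensor F x y) \<noteq> 0"
    and "\<And>l. (\<Sum>i\<in>UNIV. fundamental_tensor F x y $ l $ i * G $ i) =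
      1/4 * ((\<Sum>k\<in>UNIV. dy l (dx k (\<lambda>x y. (F x y)\<^sup>2)) x y * y $ k) - dx l (\<lambda>x y. (F x y)\<^sup>2) x y)"
  shows "finsler_spray F x y = G"
proof -
  define g where "g = fundamental_tensor F x y"
  define r :: "real ^ 'a" where "r = (\<chi> l. 1/4 * ((\<Sum>k\<in>UNIV. dy l (dx k (\<lambda>x y. (F x y)\<^sup>2)) x y * y $ k)
      - dx l (\<lambda>x y. (F x y)\<^sup>2) x y))"
  have "g *v G = r"
    using assms(2) by (simp add: vec_eq_iff g_def r_def matrix_vector_mult_def)
  moreover have "finsler_spray F x y = matrix_inv g *v r"
    unfolding finsler_spray_def Let_def
    by (simp add: vec_eq_iff g_def r_def matrix_vector_mult_def sum_distrib_left mult_ac)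
  ultimately show ?thesis
    using assms(1) by (metis g_def matrix_inv_inverse(2) matrix_vector_mul_assoc matrix_vector_mul_lid)
qed

locale metric_chart =
  fixes U :: "(real ^ 'n::finite) set" and a :: "real ^ 'n \<Rightarrow> real ^ 'n ^ 'n"
  assumes open_U: "open U"
    and smooth_a: "smooth_on U a"
    and transpose_a: "\<And>x. x \<in> U \<Longrightarrow> transpose (a x) = a x"
    and pos_a: "\<And>x y. x \<in> U \<Longrightarrow> y \<noteq> 0 \<Longrightarrow> y \<bullet> (a x *v y) > 0"
begin

lemma a_sym: "x \<in> U \<Longrightarrow> a x $ i $ j = a x $ j $ i"
  using transpose_a[of x] by (metis transpose_def vec_lambda_beta)

lemma smooth_a_entry [smooth_intros]: "smooth_on U (\<lambda>x. a x $ i $ j)"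
  by (intro smooth_on_component open_U smooth_a)

lemma has_pd_a: "x \<in> U \<Longrightarrow> has_pd k (\<lambda>x. a x $ i $ j) (dmetric a x k i j) x"
  unfolding dmetric_def by (rule smooth_on_has_pd[OF smooth_a_entry])

lemma dmetric_sym: "x \<in> U \<Longrightarrow> dmetric a x k i j = dmetric a x k j i"
  unfolding dmetric_def by (rule pd_cong[OF open_U]) (auto intro: a_sym)

lemma sqnorm_pos: "x \<in> U \<Longrightarrow> y \<noteq> 0 \<Longrightarrow> sqnorm a x y > 0"
  by (simp add: sqnorm_inner pos_a)

lemma sqnorm_nonneg: "x \<in> U \<Longrightarrow> sqnorm a x y \<ge> 0"
  using sqnorm_pos[of x y] by (cases "y = 0") (auto simp: sqnorm_def intro: less_imp_le)

lemma alpha_pos: "x \<in> U \<Longrightarrow> y \<noteq> 0 \<Longrightarrow> alpha a x y > 0"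
  by (simp add: alpha_eq sqnorm_pos)

lemma alpha_square: "x \<in> U \<Longrightarrow> (alpha a x y)\<^sup>2 = sqnorm a x y"
  by (simp add: alpha_eq sqnorm_nonneg)

lemma det_nonzero: "x \<in> U \<Longrightarrow> det (a x) \<noteq> 0"
proof -
  assume x: "x \<in> U"
  have "y = 0" if "a x *v y = 0" for y
    using pos_a[OF x, of y] that by auto
  then show ?thesis
    by (metis invertible_det_nz invertible_left_inverse matrix_left_invertible_ker)
qed

lemma upper_right: "x \<in> U \<Longrightarrow> (\<Sum>l\<in>UNIV. a x $ i $ l * upper a x l j) = (if i = j then 1 else 0)"
  using matrix_inv_inverse(1)[OF det_nonzero, of x]
  by (simp add: upper_def vec_eq_iff matrix_matrix_mult_def mat_def)

lemma upper_sym: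
  assumes "x \<in> U"
  shows "upper a x i j = upper a x j i"
proof -
  have "transpose (matrix_inv (a x)) ** a x = mat 1"
    using matrix_inv_inverse(1)[OF det_nonzero[OF assms]] transpose_a[OF assms]
    by (metis matrix_transpose_mul transpose_mat)
  then have "transpose (matrix_inv (a x)) = matrix_inv (a x)"
    using matrix_inv_inverse(1)[OF det_nonzero[OF assms]]
    by (metis matrix_mul_assoc matrix_mul_lid matrix_mul_rid)
  then have "transpose (matrix_inv (a x)) $ i $ j = matrix_inv (a x) $ i $ j" by (rule arg_cong)
  then show ?thesis by (simp add: upper_def transpose_def)
qed

lemma a_upper_cancel:
  assumes "x \<in> U"
  shows "(\<Sum>i\<in>UNIV. a x $ l $ i * (\<Sum>m\<in>UNIV. upper a x i m * X m)) = X l"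
proof -
  have "(\<Sum>i\<in>UNIV. a x $ l $ i * (\<Sum>m\<in>UNIV. upper a x i m * X m)) =
      (\<Sum>m\<in>UNIV. (\<Sum>i\<in>UNIV. a x $ l $ i * upper a x i m) * X m)"
    unfolding sum_distrib_left sum_distrib_right by (subst sum.swap) (simp add: mult.assoc)
  then show ?thesis by (simp add: upper_right[OF assms] if_distrib[of "\<lambda>t. t * _"] cong: if_cong)
qed

lemma smooth_upper [smooth_intros]: "smooth_on U (\<lambda>x. upper a x i j)"
  unfolding upper_def by (intro smooth_on_matrix_inv open_U smooth_a_entry det_nonzero)

lemma smooth_christoffel [smooth_intros]: "smooth_on U (\<lambda>x. christoffel a x i j k)"
  unfolding christoffel_def by (intro smooth_intros smooth_on_pd open_U)

lemma christoffel_sym: "x \<in> U \<Longrightarrow> christoffel a x i j k = christoffel a x i k j"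
  unfolding christoffel_def dmetric_def[symmetric] by (simp add: dmetric_sym[of x _ j k] add.commute)

lemma lower_christoffel:
  assumes "x \<in> U"
  shows "(\<Sum>i\<in>UNIV. a x $ l $ i * christoffel a x i j k) =
    1/2 * (dmetric a x j l k + dmetric a x k l j - dmetric a x l j k)"
  using a_upper_cancel[OF assms, of l "\<lambda>l. 1/2 * (dmetric a x j l k + dmetric a x k l j - dmetric a x l j k)"]
  unfolding christoffel_def dmetric_def[symmetric] by (simp add: sum_distrib_left mult_ac)

text \<open>Metric compatibility of the connection: the horizontal derivative of \<open>\<alpha>\<^sup>2\<close> vanishes. Two of the three
  terms of the Christoffel symbol cancel, being exchanged when the two indices contracted with \<open>y\<close> are.\<close>

lemma lower_conn:
  assumes "x \<in> U"
  shows "(\<Sum>i\<in>UNIV. lower a x y i * conn a x y i s) = 1/2 * dsqnorm a x y s"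
proof -
  have "(\<Sum>i\<in>UNIV. lower a x y i * conn a x y i s) =
      (\<Sum>i\<in>UNIV. \<Sum>l\<in>UNIV. \<Sum>k\<in>UNIV. y $ l * y $ k * (a x $ l $ i * christoffel a x i s k))"
    unfolding lower_def conn_def sum_product
    by (intro sum.cong refl) (simp add: a_sym[OF assms] mult_ac)
  also have "\<dots> = (\<Sum>l\<in>UNIV. \<Sum>k\<in>UNIV. y $ l * y $ k * (\<Sum>i\<in>UNIV. a x $ l $ i * christoffel a x i s k))"
    unfolding sum_distrib_left
    by (subst sum.swap, rule sum.cong[OF refl], subst sum.swap, rule refl)
  also have "\<dots> = 1/2 * dsqnorm a x y s + 1/2 * (\<Sum>l\<in>UNIV. \<Sum>k\<in>UNIV. y $ l * y $ k * dmetric a x k l s)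
      - 1/2 * (\<Sum>l\<in>UNIV. \<Sum>k\<in>UNIV. y $ l * y $ k * dmetric a x l s k)"
    unfolding lower_christoffel[OF assms] dsqnorm_def
    by (simp add: sum_distrib_left algebra_simps sum.distrib sum_subtractf)
  also have "(\<Sum>l\<in>UNIV. \<Sum>k\<in>UNIV. y $ l * y $ k * dmetric a x k l s) =
      (\<Sum>l\<in>UNIV. \<Sum>k\<in>UNIV. y $ l * y $ k * dmetric a x l s k)"
    by (subst sum.swap) (simp add: dmetric_sym[OF assms, of _ s] mult_ac)
  finally show ?thesis by simp
qed

text \<open>The right-hand side is half the Euler-Lagrange expression of \<open>\<alpha>\<^sup>2\<close>.\<close>

lemma a_geo:
  assumes "x \<in> U"
  shows "(\<Sum>i\<in>UNIV. a x $ l $ i * geo a x y i) =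
    (\<Sum>j\<in>UNIV. (\<Sum>k\<in>UNIV. dmetric a x j l k * y $ k) * y $ j) - 1/2 * dsqnorm a x y l"
proof -
  have "(\<Sum>i\<in>UNIV. a x $ l $ i * geo a x y i) =
      (\<Sum>i\<in>UNIV. \<Sum>j\<in>UNIV. \<Sum>k\<in>UNIV. y $ j * y $ k * (a x $ l $ i * christoffel a x i j k))"
    unfolding geo_def conn_def by (simp add: sum_distrib_left sum_distrib_right mult_ac)
  also have "\<dots> = (\<Sum>j\<in>UNIV. \<Sum>k\<in>UNIV. y $ j * y $ k * (\<Sum>i\<in>UNIV. a x $ l $ i * christoffel a x i j k))"
    unfolding sum_distrib_left
    by (subst sum.swap, rule sum.cong[OF refl], subst sum.swap, rule refl)
  also have "\<dots> = 1/2 * (\<Sum>j\<in>UNIV. \<Sum>k\<in>UNIV. y $ j * y $ k * dmetric a x j l k)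
      + 1/2 * (\<Sum>j\<in>UNIV. \<Sum>k\<in>UNIV. y $ j * y $ k * dmetric a x k l j) - 1/2 * dsqnorm a x y l"
    unfolding lower_christoffel[OF assms] dsqnorm_def
    by (simp add: sum_distrib_left algebra_simps sum.distrib sum_subtractf)
  also have "(\<Sum>j\<in>UNIV. \<Sum>k\<in>UNIV. y $ j * y $ k * dmetric a x k l j) =
      (\<Sum>j\<in>UNIV. \<Sum>k\<in>UNIV. y $ j * y $ k * dmetric a x j l k)"
    by (subst sum.swap) (simp add: mult_ac)
  finally show ?thesis by (simp add: sum_distrib_left sum_distrib_right mult_ac)
qed

lemma lower_geo:
  assumes "x \<in> U"
  shows "(\<Sum>i\<in>UNIV. lower a x y i * geo a x y i) = 1/2 * (\<Sum>s\<in>UNIV. dsqnorm a x y s * y $ s)"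
proof -
  have "(\<Sum>i\<in>UNIV. lower a x y i * geo a x y i) =
      (\<Sum>s\<in>UNIV. (\<Sum>i\<in>UNIV. lower a x y i * conn a x y i s) * y $ s)"
    unfolding geo_def sum_distrib_left sum_distrib_right
    by (subst sum.swap) (simp add: mult.assoc)
  then show ?thesis by (simp add: lower_conn[OF assms] sum_distrib_left)
qed

text \<open>The trace \<open>\<Gamma>\<^sup>m\<^sub>m\<^sub>j\<close> is the logarithmic derivative of the Riemannian density. The latter is taken as the
  fourth root of \<open>(det a)\<^sup>2\<close>, for which it is enough to know that the determinant does not vanish.\<close>

lemma trace_christoffel:
  assumes "x \<in> U"
  shows "has_pd j (\<lambda>x. 1/4 * ln ((det (a x))\<^sup>2)) (\<Sum>m\<in>UNIV. christoffel a x m m j) x"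
proof -
  have "has_pd j (\<lambda>x. det (a x))
      (det (a x) * (\<Sum>i\<in>UNIV. \<Sum>l\<in>UNIV. dmetric a x j i l * upper a x l i)) x"
    using Jacobi_formula[of "\<lambda>t. a (x + t *\<^sub>R axis j 1)" "\<chi> i l. dmetric a x j i l" 0]
      has_pd_a[OF assms] det_nonzero[OF assms]
    unfolding has_pd_def upper_def by simp
  then have D: "has_pd j (\<lambda>x. 1/4 * ln ((det (a x))\<^sup>2)) (0 * ln ((det (a x))\<^sup>2) + 1/4 * (2 * det (a x) *
      (det (a x) * (\<Sum>i\<in>UNIV. \<Sum>l\<in>UNIV. dmetric a x j i l * upper a x l i)) / (det (a x))\<^sup>2)) x"
    using det_nonzero[OF assms] by (intro pd_intros) auto
  have E: "0 * ln ((det (a x))\<^sup>2) + 1/4 * (2 * det (a x) *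
      (det (a x) * (\<Sum>i\<in>UNIV. \<Sum>l\<in>UNIV. dmetric a x j i l * upper a x l i)) / (det (a x))\<^sup>2) =
      1/2 * (\<Sum>i\<in>UNIV. \<Sum>l\<in>UNIV. dmetric a x j i l * upper a x l i)"
    using det_nonzero[OF assms] by (simp add: power2_eq_square)
  have T: "(\<Sum>m\<in>UNIV. christoffel a x m m j) =
      1/2 * (\<Sum>i\<in>UNIV. \<Sum>l\<in>UNIV. dmetric a x j i l * upper a x l i)"
  proof -
    have "(\<Sum>m\<in>UNIV. christoffel a x m m j) =
        1/2 * (\<Sum>m\<in>UNIV. \<Sum>l\<in>UNIV. upper a x m l * dmetric a x m l j)
        + 1/2 * (\<Sum>m\<in>UNIV. \<Sum>l\<in>UNIV. upper a x m l * dmetric a x j l m)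
        - 1/2 * (\<Sum>m\<in>UNIV. \<Sum>l\<in>UNIV. upper a x m l * dmetric a x l m j)"
      unfolding christoffel_def dmetric_def[symmetric]
      by (simp add: sum_distrib_left algebra_simps sum.distrib sum_subtractf)
    also have "(\<Sum>m\<in>UNIV. \<Sum>l\<in>UNIV. upper a x m l * dmetric a x l m j) =
        (\<Sum>m\<in>UNIV. \<Sum>l\<in>UNIV. upper a x m l * dmetric a x m l j)"
      by (subst sum.swap) (simp add: upper_sym[OF assms])
    also have "(\<Sum>m\<in>UNIV. \<Sum>l\<in>UNIV. upper a x m l * dmetric a x j l m) =
        (\<Sum>i\<in>UNIV. \<Sum>l\<in>UNIV. dmetric a x j i l * upper a x l i)"
      by (subst sum.swap) (simp add: mult_ac)
    finally show ?thesis by simp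
  qed
  show ?thesis by (rule has_pd_eq[OF D]) (simp only: E T)
qed

subsection \<open>Derivatives of the norm and of the geodesic coefficients\<close>

lemma has_pd_lower: "has_pd j (\<lambda>y. lower a x y l) (a x $ l $ j) y"
  unfolding lower_def
  by (rule has_pd_eq, (assumption | rule pd_intros)+) (simp add: mult_delta_right)

lemma has_pd_sqnorm_y:
  assumes "x \<in> U"
  shows "has_pd j (\<lambda>y. sqnorm a x y) (2 * lower a x y j) y"
  unfolding sqnorm_lower
  by (rule has_pd_eq, (assumption | rule pd_intros has_pd_lower)+)
    (simp add: sum.distrib mult_delta_right a_sym[OF assms, of _ j] lower_def)

lemma has_pd_sqnorm_x: "x \<in> U \<Longrightarrow> has_pd k (\<lambda>x. sqnorm a x y) (dsqnorm a x y k) x"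
  unfolding sqnorm_def dsqnorm_def
  by (rule has_pd_eq, (assumption | rule pd_intros has_pd_a)+) (auto simp: sum_distrib_left mult_ac)

lemma has_pd_alpha_y:
  assumes "x \<in> U" "y \<noteq> 0"
  shows "has_pd j (\<lambda>y. alpha a x y) (lower a x y j / alpha a x y) y"
  unfolding alpha_eq
  by (rule has_pd_eq, (assumption | rule pd_intros has_pd_sqnorm_y assms sqnorm_pos)+) simp

lemma has_pd_alpha_x:
  assumes "x \<in> U" "y \<noteq> 0"
  shows "has_pd k (\<lambda>x. alpha a x y) (dsqnorm a x y k / (2 * alpha a x y)) x"
  unfolding alpha_eq by (intro pd_intros has_pd_sqnorm_x assms sqnorm_pos)

lemma has_pd_dsqnorm:
  assumes "x \<in> U"
  shows "has_pd l (\<lambda>y. dsqnorm a x y k) (2 * (\<Sum>j\<in>UNIV. dmetric a x k l j * y $ j)) y"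
proof -
  have *: "dsqnorm a x y k = (\<Sum>i\<in>UNIV. (\<Sum>j\<in>UNIV. dmetric a x k i j * y $ j) * y $ i)" for y
    unfolding dsqnorm_def by (simp add: sum_distrib_left sum_distrib_right mult_ac)
  show ?thesis
    unfolding *
    by (rule has_pd_eq, (assumption | rule pd_intros)+)
      (simp add: sum.distrib mult_delta_right dmetric_sym[OF assms, of _ _ l])
qed

lemma has_pd_conn_y: "has_pd j (\<lambda>y. conn a x y i s) (christoffel a x i s j) y"
  unfolding conn_def by (rule has_pd_eq, (assumption | rule pd_intros)+) (simp add: mult_delta_right)

lemma has_pd_conn_x:
  "x \<in> U \<Longrightarrow> has_pd j (\<lambda>x. conn a x y i s) (\<Sum>k\<in>UNIV. pd j (\<lambda>x. christoffel a x i s k) x * y $ k) x"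
  unfolding conn_def
  by (rule has_pd_eq, (assumption | rule pd_intros smooth_on_has_pd[OF smooth_christoffel])+) auto

lemma has_pd_geo_y:
  assumes "x \<in> U"
  shows "has_pd s (\<lambda>y. geo a x y i) (2 * conn a x y i s) y"
  unfolding geo_def
  by (rule has_pd_eq, (assumption | rule pd_intros has_pd_conn_y)+)
    (simp add: sum.distrib mult_delta_right christoffel_sym[OF assms, of _ _ s] conn_def)

lemma has_pd_geo_x:
  "x \<in> U \<Longrightarrow> has_pd j (\<lambda>x. geo a x y i)
     (\<Sum>s\<in>UNIV. (\<Sum>k\<in>UNIV. pd j (\<lambda>x. christoffel a x i s k) x * y $ k) * y $ s) x"
  unfolding geo_def
  by (rule has_pd_eq, (assumption | rule pd_intros has_pd_conn_x)+) auto

subsection \<open>The spray and the Ricci curvature of a Riemannian metric\<close>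

lemma finsler_spray_alpha:
  assumes x: "x \<in> U"
  shows "finsler_spray (alpha a) x y $ i = 1/2 * geo a x y i"
proof -
  have dyq: "dy i (\<lambda>x y. (alpha a x y)\<^sup>2) x y = 2 * lower a x y i" for i y
    unfolding dy_def by (rule has_pd_imp_pd) (simp add: alpha_square[OF x] has_pd_sqnorm_y[OF x])
  have dxq: "dx k (\<lambda>x y. (alpha a x y)\<^sup>2) x y = dsqnorm a x y k" for k y
    unfolding dx_def
    by (rule has_pd_imp_pd, rule has_pd_cong[OF open_U x _ has_pd_sqnorm_x[OF x]]) (simp add: alpha_square)
  have ft: "fundamental_tensor (alpha a) x y = a x"
  proof -
    have "dy j (dy i (\<lambda>x y. (alpha a x y)\<^sup>2)) x y = 2 * a x $ i $ j" for i j
    proof -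
      have "has_pd j (\<lambda>y. 2 * lower a x y i) (0 * lower a x y i + 2 * a x $ i $ j) y"
        by (intro pd_intros has_pd_lower)
      then show ?thesis unfolding dy_def[of j] dyq using has_pd_imp_pd by fastforce
    qed
    then show ?thesis by (simp add: fundamental_tensor_def vec_eq_iff)
  qed
  have "finsler_spray (alpha a) x y = (\<chi> i. 1/2 * geo a x y i)"
  proof (rule finsler_spray_eqI)
    show "det (fundamental_tensor (alpha a) x y) \<noteq> 0" unfolding ft by (rule det_nonzero[OF x])
    fix l
    have "dy l (dx k (\<lambda>x y. (alpha a x y)\<^sup>2)) x y = 2 * (\<Sum>j\<in>UNIV. dmetric a x k l j * y $ j)" for k
      unfolding dy_def dxq by (rule has_pd_imp_pd[OF has_pd_dsqnorm[OF x]])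
    then have "1/4 * ((\<Sum>k\<in>UNIV. dy l (dx k (\<lambda>x y. (alpha a x y)\<^sup>2)) x y * y $ k)
        - dx l (\<lambda>x y. (alpha a x y)\<^sup>2) x y) = 1/2 * (\<Sum>i\<in>UNIV. a x $ l $ i * geo a x y i)"
      by (simp only: a_geo[OF x] dxq) (simp add: sum_distrib_left mult_ac)
    then show "(\<Sum>i\<in>UNIV. fundamental_tensor (alpha a) x y $ l $ i * (\<chi> i. 1/2 * geo a x y i) $ i) =
        1/4 * ((\<Sum>k\<in>UNIV. dy l (dx k (\<lambda>x y. (alpha a x y)\<^sup>2)) x y * y $ k)
        - dx l (\<lambda>x y. (alpha a x y)\<^sup>2) x y)"
      unfolding ft by (simp add: sum_distrib_left mult_ac)
  qed
  then show ?thesis by simp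
qed

lemma trace_conn: "(\<Sum>m\<in>UNIV. conn a x y m m) = (\<Sum>k\<in>UNIV. (\<Sum>m\<in>UNIV. christoffel a x m m k) * y $ k)"
  unfolding conn_def by (subst sum.swap) (simp add: sum_distrib_right)

lemma has_pd_trace_christoffel:
  "x \<in> U \<Longrightarrow> has_pd j (\<lambda>x. \<Sum>m\<in>UNIV. christoffel a x m m k) (\<Sum>m\<in>UNIV. pd j (\<lambda>x. christoffel a x m m k) x) x"
  by (intro pd_intros smooth_on_has_pd[OF smooth_christoffel])

text \<open>The curvature is left as a sum of traces, in the form in which the same traces occur in the Ricci
  curvature of the projective spray of a Randers metric.\<close>

lemma Ric_alpha:
  assumes x: "x \<in> U"
  shows "Ric (finsler_spray (alpha a)) x y =
    (\<Sum>m\<in>UNIV. \<Sum>s\<in>UNIV. (\<Sum>k\<in>UNIV. pd m (\<lambda>x. christoffel a x m s k) x * y $ k) * y $ s)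
    - (\<Sum>j\<in>UNIV. y $ j * (\<Sum>k\<in>UNIV. (\<Sum>m\<in>UNIV. pd j (\<lambda>x. christoffel a x m m k) x) * y $ k))
    + (\<Sum>j\<in>UNIV. geo a x y j * (\<Sum>m\<in>UNIV. christoffel a x m m j))
    - (\<Sum>m\<in>UNIV. \<Sum>s\<in>UNIV. conn a x y m s * conn a x y s m)"
proof -
  have "Ric (finsler_spray (alpha a)) x y =
    2 * (\<Sum>m\<in>UNIV. 0 * geo a x y m
      + 1/2 * (\<Sum>s\<in>UNIV. (\<Sum>k\<in>UNIV. pd m (\<lambda>x. christoffel a x m s k) x * y $ k) * y $ s))
    - (\<Sum>j\<in>UNIV. y $ j * (\<Sum>k\<in>UNIV. (\<Sum>m\<in>UNIV. pd j (\<lambda>x. christoffel a x m m k) x) * y $ k))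
    + 2 * (\<Sum>j\<in>UNIV. (1/2 * geo a x y j) * (\<Sum>m\<in>UNIV. christoffel a x m m j))
    - (\<Sum>m\<in>UNIV. \<Sum>s\<in>UNIV. conn a x y m s * conn a x y s m)"
  proof (rule Ric_of_linear_divergence[OF open_U x open_UNIV UNIV_I, where K = "\<lambda>m x y. 1/2 * geo a x y m"])
    show "has_pd s (\<lambda>y. 1/2 * geo a x y m) (conn a x y m s) y" if "x \<in> U" for x y m s
      by (rule has_pd_eq, (assumption | rule pd_intros has_pd_geo_y that)+) simp
  qed (assumption | rule x finsler_spray_alpha has_pd_geo_x has_pd_trace_christoffel trace_conn exI
      has_pd_conn_x has_pd_conn_y pd_intros)+
  then show ?thesis by (simp add: sum_distrib_left)
qed

end

section \<open>The spray of a Randers metric\<close>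

definition dform :: "(real ^ 'n \<Rightarrow> real ^ 'n) \<Rightarrow> real ^ 'n::finite \<Rightarrow> 'n \<Rightarrow> 'n \<Rightarrow> real" where
  "dform b x k l = pd k (\<lambda>x. b x $ l) x"

text \<open>In the usual notation this is \<open>P = (r\<^sub>0\<^sub>0 - 2 \<alpha> s\<^sub>0) / (2 F)\<close>,
  the component of the spray of \<open>F = \<alpha> + \<beta>\<close> along \<open>y\<close>.\<close>

definition radial_part ::
    "(real ^ 'n \<Rightarrow> real ^ 'n ^ 'n) \<Rightarrow> (real ^ 'n \<Rightarrow> real ^ 'n) \<Rightarrow> real ^ 'n::finite \<Rightarrow> real ^ 'n \<Rightarrow> real" where
  "radial_part a b x y =
     ((\<Sum>i\<in>UNIV. \<Sum>j\<in>UNIV. cov_form a b x i j * y $ i * y $ j)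
       - 2 * alpha a x y * (\<Sum>i\<in>UNIV. b x $ i * s_up_0 a b x y i)) / (2 * randers a b x y)"

context metric_chart
begin

lemma inner_a_commute:
  assumes "x \<in> U"
  shows "u \<bullet> (a x *v v) = v \<bullet> (a x *v u)"
  by (metis assms dot_lmul_matrix inner_commute transpose_a transpose_matrix_vector)

text \<open>Lagrange's identity behind the Cauchy-Schwarz inequality; it also settles the case of equality.\<close>

lemma Cauchy_Schwarz_identity:
  assumes "x \<in> U"
  defines "z u v \<equiv> (v \<bullet> (a x *v v)) *\<^sub>R u - (u \<bullet> (a x *v v)) *\<^sub>R v"
  shows "z u v \<bullet> (a x *v z u v) =
    (v \<bullet> (a x *v v)) * ((u \<bullet> (a x *v u)) * (v \<bullet> (a x *v v)) - (u \<bullet> (a x *v v))\<^sup>2)"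
  unfolding z_def
  by (simp add: matrix_vector_mult_diff_distrib matrix_vector_mult_scaleR inner_diff_left
      inner_diff_right inner_a_commute[OF assms(1), of v u] algebra_simps power2_eq_square)

lemma Cauchy_Schwarz:
  assumes "x \<in> U"
  shows "(u \<bullet> (a x *v v))\<^sup>2 \<le> (u \<bullet> (a x *v u)) * (v \<bullet> (a x *v v))"
proof (cases "v = 0")
  case False
  then have "v \<bullet> (a x *v v) > 0" using pos_a[OF assms] by blast
  moreover have "z \<bullet> (a x *v z) \<ge> 0" for z
    using pos_a[OF assms, of z] by (cases "z = 0") auto
  ultimately show ?thesis
    using Cauchy_Schwarz_identity[OF assms, of v u] by (metis diff_ge_0_iff_ge zero_le_mult_iff not_le)
qed simp

end

locale randers_chart = metric_chart U a
  for U :: "(real ^ 'n::finite) set" and a :: "real ^ 'n \<Rightarrow> real ^ 'n ^ 'n" +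
  fixes b :: "real ^ 'n \<Rightarrow> real ^ 'n"
  assumes smooth_b: "smooth_on U b"
    and norm_b: "\<And>x. x \<in> U \<Longrightarrow> one_form_norm a b x < 1"
begin

lemma smooth_b_entry [smooth_intros]: "smooth_on U (\<lambda>x. b x $ i)"
  by (intro smooth_on_component open_U smooth_b)

lemma has_pd_b: "x \<in> U \<Longrightarrow> has_pd k (\<lambda>x. b x $ l) (dform b x k l) x"
  unfolding dform_def by (rule smooth_on_has_pd[OF smooth_b_entry])

lemma smooth_s_low [smooth_intros]: "smooth_on U (\<lambda>x. s_low a b x i j)"
  unfolding s_low_def cov_form_def by (intro smooth_intros smooth_on_pd open_U)

lemma smooth_s_mix [smooth_intros]: "smooth_on U (\<lambda>x. s_mix a b x i j)"
  unfolding s_mix_def by (intro smooth_intros open_U)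

lemma s_low_eq: "x \<in> U \<Longrightarrow> s_low a b x i j = 1/2 * (dform b x j i - dform b x i j)"
  unfolding s_low_def cov_form_def dform_def by (simp add: christoffel_sym[of x _ j i])

lemma s_low_antisym: "s_low a b x i j = - s_low a b x j i"
  unfolding s_low_def by (simp add: field_simps)

lemma a_s_mix: "x \<in> U \<Longrightarrow> (\<Sum>i\<in>UNIV. a x $ l $ i * s_mix a b x i j) = s_low a b x l j"
  unfolding s_mix_def by (rule a_upper_cancel)

lemma lower_s_mix:
  assumes "x \<in> U"
  shows "(\<Sum>i\<in>UNIV. lower a x y i * s_mix a b x i j) = s_low_0 a b x y j"
proof -
  have "(\<Sum>i\<in>UNIV. lower a x y i * s_mix a b x i j) =
      (\<Sum>l\<in>UNIV. (\<Sum>i\<in>UNIV. a x $ l $ i * s_mix a b x i j) * y $ l)"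
    unfolding lower_def sum_distrib_right
    by (subst sum.swap, intro sum.cong refl) (simp add: a_sym[OF assms] mult_ac)
  then show ?thesis by (simp add: a_s_mix[OF assms] s_low_0_def)
qed

lemma a_s_up_0:
  assumes "x \<in> U"
  shows "(\<Sum>i\<in>UNIV. a x $ l $ i * s_up_0 a b x y i) = (\<Sum>j\<in>UNIV. s_low a b x l j * y $ j)"
proof -
  have "(\<Sum>i\<in>UNIV. a x $ l $ i * s_up_0 a b x y i) =
      (\<Sum>j\<in>UNIV. (\<Sum>i\<in>UNIV. a x $ l $ i * s_mix a b x i j) * y $ j)"
    unfolding s_up_0_def sum_distrib_right sum_distrib_left
    by (subst sum.swap) (simp add: mult.assoc)
  then show ?thesis by (simp add: a_s_mix[OF assms])
qed

text \<open>This is \<open>s\<^sub>0\<^sub>0 = 0\<close>; it makes \<open>\<alpha> s\<^sup>i\<^sub>0\<close> tangent to the spheres of \<open>\<alpha>\<close> and, as \<open>s\<^sup>i\<^sub>i = 0\<close>,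
  divergence free.\<close>

lemma lower_s_up_0:
  assumes "x \<in> U"
  shows "(\<Sum>i\<in>UNIV. lower a x y i * s_up_0 a b x y i) = 0"
proof -
  have "(\<Sum>i\<in>UNIV. lower a x y i * s_up_0 a b x y i) =
      (\<Sum>j\<in>UNIV. (\<Sum>i\<in>UNIV. lower a x y i * s_mix a b x i j) * y $ j)"
    unfolding s_up_0_def sum_distrib_right sum_distrib_left
    by (subst sum.swap) (simp add: mult.assoc)
  also have "\<dots> = (\<Sum>j\<in>UNIV. \<Sum>i\<in>UNIV. s_low a b x i j * y $ i * y $ j)"
    by (simp add: lower_s_mix[OF assms] s_low_0_def sum_distrib_right)
  finally have eq: "(\<Sum>i\<in>UNIV. lower a x y i * s_up_0 a b x y i) =
      (\<Sum>j\<in>UNIV. \<Sum>i\<in>UNIV. s_low a b x i j * y $ i * y $ j)" .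
  have "(\<Sum>j\<in>UNIV. \<Sum>i\<in>UNIV. s_low a b x i j * y $ i * y $ j) =
      (\<Sum>j\<in>UNIV. \<Sum>i\<in>UNIV. s_low a b x j i * y $ j * y $ i)"
    by (rule sum.swap)
  also have "\<dots> = (\<Sum>j\<in>UNIV. \<Sum>i\<in>UNIV. - (s_low a b x i j * y $ i * y $ j))"
    by (intro sum.cong refl) (subst s_low_antisym, simp)
  finally show ?thesis using eq by (simp add: sum_negf)
qed

lemma trace_s_mix:
  assumes "x \<in> U"
  shows "(\<Sum>m\<in>UNIV. s_mix a b x m m) = 0"
proof -
  have "(\<Sum>m\<in>UNIV. s_mix a b x m m) = (\<Sum>m\<in>UNIV. \<Sum>l\<in>UNIV. upper a x l m * s_low a b x m l)"
    unfolding s_mix_def by (rule sum.swap)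
  also have "\<dots> = (\<Sum>m\<in>UNIV. \<Sum>l\<in>UNIV. - (upper a x m l * s_low a b x l m))"
    by (intro sum.cong refl) (subst s_low_antisym, simp add: upper_sym[OF assms])
  finally show ?thesis unfolding s_mix_def by (simp add: sum_negf)
qed

text \<open>With \<open>w\<close> the vector dual to \<open>b\<close>, Cauchy-Schwarz bounds \<open>\<beta>(y) = \<langle>w, y\<rangle>\<close>.\<close>

lemma randers_pos:
  assumes x: "x \<in> U" and y: "y \<noteq> 0"
  shows "randers a b x y > 0"
proof -
  define w where "w = matrix_inv (a x) *v b x"
  have aw: "a x *v w = b x"
    by (simp add: w_def matrix_vector_mul_assoc matrix_inv_inverse det_nonzero[OF x])
  have "one_form_norm a b x = sqrt (b x \<bullet> (matrix_inv (a x) *v b x))"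
    unfolding one_form_norm_def upper_def inner_vec_def matrix_vector_mult_def
    by (simp add: sum_distrib_left mult_ac)
  then have w: "w \<bullet> (a x *v w) < 1"
    using norm_b[OF x] by (simp add: w_def[symmetric] aw inner_commute)
  have "beta b x y = y \<bullet> (a x *v w)"
    unfolding aw beta_def inner_vec_def by (simp add: mult.commute)
  then have "(beta b x y)\<^sup>2 \<le> (w \<bullet> (a x *v w)) * sqnorm a x y"
    using Cauchy_Schwarz[OF x, of y w] by (simp add: sqnorm_inner mult.commute)
  also have "\<dots> < 1 * sqnorm a x y"
    using w sqnorm_pos[OF x y] by (rule mult_strict_right_mono)
  finally have "\<bar>beta b x y\<bar> < alpha a x y"
    using alpha_square[OF x, of y] alpha_pos[OF x y]
    by (intro power2_less_imp_less[of "\<bar>beta b x y\<bar>"]) auto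
  then show ?thesis unfolding randers_def by simp
qed

lemma has_pd_beta_y: "has_pd j (\<lambda>y. beta b x y) (b x $ j) y"
  unfolding beta_def
  by (rule has_pd_eq, (assumption | rule pd_intros)+) (simp add: mult_delta_right)

lemma has_pd_randers_y:
  assumes "x \<in> U" "y \<noteq> 0"
  shows "has_pd j (\<lambda>y. randers a b x y) (lower a x y j / alpha a x y + b x $ j) y"
  unfolding randers_def by (intro pd_intros has_pd_alpha_y has_pd_beta_y assms)

lemma has_pd_randers_x:
  assumes "x \<in> U" "y \<noteq> 0"
  shows "has_pd k (\<lambda>x. randers a b x y)
    (dsqnorm a x y k / (2 * alpha a x y) + (\<Sum>l\<in>UNIV. dform b x k l * y $ l)) x"
  unfolding randers_def beta_def
  by (rule has_pd_eq, (assumption | rule pd_intros has_pd_alpha_x has_pd_b assms)+) simp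

lemma dy_randers_square:
  assumes "x \<in> U" "y \<noteq> 0"
  shows "dy i (\<lambda>x y. (randers a b x y)\<^sup>2) x y =
    2 * randers a b x y * (lower a x y i / alpha a x y + b x $ i)"
  unfolding dy_def by (intro has_pd_imp_pd pd_intros has_pd_randers_y assms)

lemma dx_randers_square:
  assumes "x \<in> U" "y \<noteq> 0"
  shows "dx k (\<lambda>x y. (randers a b x y)\<^sup>2) x y = 2 * randers a b x y *
    (dsqnorm a x y k / (2 * alpha a x y) + (\<Sum>l\<in>UNIV. dform b x k l * y $ l))"
  unfolding dx_def by (intro has_pd_imp_pd pd_intros has_pd_randers_x assms)

lemma open_nonzero: "open (- {0 :: real ^ 'n})"
  by auto

lemma has_pd_lower_div_alpha:
  assumes "x \<in> U" "y \<noteq> 0"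
  shows "has_pd j (\<lambda>y. lower a x y i / alpha a x y)
    ((a x $ i $ j - lower a x y i * lower a x y j / sqnorm a x y) / alpha a x y) y"
proof -
  have "has_pd j (\<lambda>y. lower a x y i / alpha a x y) ((a x $ i $ j * alpha a x y -
      lower a x y i * (lower a x y j / alpha a x y)) / (alpha a x y)\<^sup>2) y"
    using alpha_pos[OF assms] by (intro pd_intros has_pd_lower has_pd_alpha_y assms) simp
  moreover have "(a x $ i $ j * alpha a x y - lower a x y i * (lower a x y j / alpha a x y)) / (alpha a x y)\<^sup>2
      = (a x $ i $ j - lower a x y i * lower a x y j / (alpha a x y)\<^sup>2) / alpha a x y"
    using alpha_pos[OF assms] by (simp add: field_simps power2_eq_square)
  ultimately show ?thesis by (simp add: alpha_square[OF assms(1)])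
qed

lemma fundamental_tensor_randers:
  assumes "x \<in> U" "y \<noteq> 0"
  shows "fundamental_tensor (randers a b) x y $ i $ j =
    (lower a x y i / alpha a x y + b x $ i) * (lower a x y j / alpha a x y + b x $ j)
    + randers a b x y / alpha a x y * (a x $ i $ j - lower a x y i * lower a x y j / sqnorm a x y)"
proof -
  have "dy j (dy i (\<lambda>x y. (randers a b x y)\<^sup>2)) x y =
      pd j (\<lambda>y. 2 * (randers a b x y * (lower a x y i / alpha a x y + b x $ i))) y"
    unfolding dy_def[of j]
    by (rule pd_cong[OF open_nonzero]) (use assms in \<open>auto simp: dy_randers_square\<close>)
  also have "\<dots> = 2 * ((lower a x y j / alpha a x y + b x $ j) * (lower a x y i / alpha a x y + b x $ i)
      + randers a b x y * ((a x $ i $ j - lower a x y i * lower a x y j / sqnorm a x y) / alpha a x y + 0))"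
    by (rule has_pd_imp_pd, rule has_pd_eq,
      (rule pd_intros has_pd_randers_y has_pd_lower_div_alpha assms)+) simp
  finally show ?thesis unfolding fundamental_tensor_def by (simp add: mult_ac)
qed

text \<open>The fundamental tensor is the sum of two positive semidefinite forms: the square of \<open>dF\<close>,
  and a multiple of the Hessian of \<open>\<alpha>\<close>, whose kernel is spanned by \<open>y\<close>. As \<open>dF(y) = F \<noteq> 0\<close>,
  no nonzero vector lies in both kernels.\<close>

lemma det_fundamental_tensor_randers:
  assumes x: "x \<in> U" and y: "y \<noteq> 0"
  shows "det (fundamental_tensor (randers a b) x y) \<noteq> 0"
proof -
  define g where "g = fundamental_tensor (randers a b) x y"
  define p where "p = (\<chi> i. lower a x y i / alpha a x y + b x $ i)"
  define c where "c = randers a b x y / alpha a x y"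
  have c: "c > 0" using randers_pos[OF x y] alpha_pos[OF x y] by (simp add: c_def)
  have ay: "(a x *v y) $ i = lower a x y i" for i
    by (simp add: matrix_vector_mult_def lower_def)
  have Y: "y \<bullet> (a x *v y) > 0" using pos_a[OF x y] .
  have gij: "g $ i $ j = p $ i * p $ j + c * a x $ i $ j - c / sqnorm a x y * (lower a x y i * lower a x y j)"
    for i j
    unfolding g_def fundamental_tensor_randers[OF x y] c_def[symmetric] by (simp add: p_def algebra_simps)
  have gv: "(g *v v) $ i = (\<Sum>j\<in>UNIV. g $ i $ j * v $ j)" for v i
    by (simp add: matrix_vector_mult_def)
  have quad: "v \<bullet> (g *v v) = (p \<bullet> v)\<^sup>2
      + c * (v \<bullet> (a x *v v) - (v \<bullet> (a x *v y))\<^sup>2 / (y \<bullet> (a x *v y)))" for v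
  proof -
    have "v \<bullet> (g *v v) = (\<Sum>i\<in>UNIV. \<Sum>j\<in>UNIV. (p $ i * v $ i) * (p $ j * v $ j)
        + c * (v $ i * (a x $ i $ j * v $ j))
        - c / sqnorm a x y * ((v $ i * (a x *v y) $ i) * (v $ j * (a x *v y) $ j)))"
      by (simp add: inner_vec_def gv gij ay sum_distrib_left algebra_simps)
    also have "\<dots> = (p \<bullet> v) * (p \<bullet> v) + c * (v \<bullet> (a x *v v))
        - c / sqnorm a x y * ((v \<bullet> (a x *v y)) * (v \<bullet> (a x *v y)))"
      unfolding inner_vec_def matrix_vector_mult_def[of "a x" v]
      by (simp add: sum.distrib sum_subtractf flip: sum_distrib_left sum_distrib_right times_divide_eq_left)
    finally show ?thesis by (simp add: sqnorm_inner power2_eq_square algebra_simps)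
  qed
  have "v = 0" if "g *v v = 0" for v
  proof -
    have nonneg: "v \<bullet> (a x *v v) - (v \<bullet> (a x *v y))\<^sup>2 / (y \<bullet> (a x *v y)) \<ge> 0"
      using Cauchy_Schwarz[OF x, of v y] Y by (simp add: field_simps)
    have sum0: "(p \<bullet> v)\<^sup>2
        + c * (v \<bullet> (a x *v v) - (v \<bullet> (a x *v y))\<^sup>2 / (y \<bullet> (a x *v y))) = 0"
      using quad[of v] that by simp
    have pv: "p \<bullet> v = 0"
      and eq: "v \<bullet> (a x *v v) - (v \<bullet> (a x *v y))\<^sup>2 / (y \<bullet> (a x *v y)) = 0"
      using sum0 nonneg c add_nonneg_eq_0_iff[OF zero_le_power2 mult_nonneg_nonneg[OF less_imp_le[OF c] nonneg]]
      by auto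
    define z where "z = (y \<bullet> (a x *v y)) *\<^sub>R v - (v \<bullet> (a x *v y)) *\<^sub>R y"
    have "(v \<bullet> (a x *v v)) * (y \<bullet> (a x *v y)) - (v \<bullet> (a x *v y))\<^sup>2 = 0"
      using eq Y by (simp add: field_simps)
    then have "z \<bullet> (a x *v z) = 0"
      unfolding z_def Cauchy_Schwarz_identity[OF x] by simp
    then have "z = 0" using pos_a[OF x, of z] by force
    then have v: "(y \<bullet> (a x *v y)) *\<^sub>R v = (v \<bullet> (a x *v y)) *\<^sub>R y" by (simp add: z_def)
    have "p \<bullet> y = sqnorm a x y / alpha a x y + beta b x y"
      unfolding p_def inner_vec_def sqnorm_lower beta_def
      by (simp add: sum.distrib sum_divide_distrib algebra_simps)
    also have "\<dots> = randers a b x y"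
      using alpha_pos[OF x y] by (simp add: randers_def alpha_square[OF x, symmetric] power2_eq_square)
    finally have py: "p \<bullet> y = randers a b x y" .
    have "(v \<bullet> (a x *v y)) * (p \<bullet> y) = (y \<bullet> (a x *v y)) * (p \<bullet> v)"
      using arg_cong[OF v, of "\<lambda>u. p \<bullet> u"] by simp
    then have "v \<bullet> (a x *v y) = 0" using py pv randers_pos[OF x y] by simp
    then show "v = 0" using v Y by simp
  qed
  then show ?thesis
    unfolding g_def[symmetric]
    by (metis invertible_det_nz invertible_left_inverse matrix_left_invertible_ker)
qed

end

context randers_chart
begin

text \<open>The covariant and the ordinary derivative of \<open>\<beta>\<close> along \<open>y\<close> differ by \<open>b\<^sub>i \<Gamma>\<^sup>i\<^sub>0\<^sub>0\<close>.\<close>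

lemma beta_geo:
  "(\<Sum>i\<in>UNIV. \<Sum>j\<in>UNIV. cov_form a b x i j * y $ i * y $ j) =
    (\<Sum>k\<in>UNIV. (\<Sum>l\<in>UNIV. dform b x k l * y $ l) * y $ k) - (\<Sum>i\<in>UNIV. b x $ i * geo a x y i)"
proof -
  have "(\<Sum>i\<in>UNIV. \<Sum>j\<in>UNIV. cov_form a b x i j * y $ i * y $ j) =
      (\<Sum>i\<in>UNIV. \<Sum>j\<in>UNIV. dform b x j i * y $ i * y $ j)
      - (\<Sum>i\<in>UNIV. \<Sum>j\<in>UNIV. \<Sum>k\<in>UNIV. christoffel a x k i j * b x $ k * y $ i * y $ j)"
    unfolding cov_form_def dform_def[symmetric]
    by (simp add: left_diff_distrib sum_subtractf sum_distrib_right)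
  also have "(\<Sum>i\<in>UNIV. \<Sum>j\<in>UNIV. dform b x j i * y $ i * y $ j) =
      (\<Sum>k\<in>UNIV. (\<Sum>l\<in>UNIV. dform b x k l * y $ l) * y $ k)"
    by (subst sum.swap) (simp add: sum_distrib_right)
  also have "(\<Sum>i\<in>UNIV. \<Sum>j\<in>UNIV. \<Sum>k\<in>UNIV. christoffel a x k i j * b x $ k * y $ i * y $ j) =
      (\<Sum>k\<in>UNIV. \<Sum>i\<in>UNIV. \<Sum>j\<in>UNIV. christoffel a x k i j * b x $ k * y $ i * y $ j)"
    by (subst sum.swap[of _ UNIV UNIV, symmetric], rule sum.cong[OF refl], rule sum.swap)
  also have "\<dots> = (\<Sum>i\<in>UNIV. b x $ i * geo a x y i)"
    unfolding geo_def conn_def by (simp add: sum_distrib_left sum_distrib_right mult_ac)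
  finally show ?thesis .
qed

text \<open>The fundamental tensor is \<open>dF \<otimes> dF + F Hess F\<close>, so it is enough to contract the coefficients with
  \<open>dF\<close> and with \<open>Hess F = Hess \<alpha>\<close>. The contraction with \<open>dF\<close> has to give half the derivative of \<open>F\<close> along
  \<open>y\<close>, and determines the radial part. The Hessian annihilates \<open>y\<close>, and its contraction with
  \<open>\<alpha> s\<^sup>i\<^sub>0\<close> accounts for the exterior derivative of \<open>\<beta>\<close>.\<close>

lemma finsler_spray_randers:
  assumes x: "x \<in> U" and y: "y \<noteq> 0"
  shows "finsler_spray (randers a b) x y $ i =
    1/2 * geo a x y i + alpha a x y * s_up_0 a b x y i + radial_part a b x y * y $ i"
proof -
  define l where "l = lower a x y"
  define \<alpha> where "\<alpha> = alpha a x y"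
  (* with a name for the inverse norm, all identities below are polynomial *)
  define v where "v = 1 / \<alpha>"
  define F where "F = randers a b x y"
  define P where "P = radial_part a b x y"
  define s where "s = s_up_0 a b x y"
  define g where "g = geo a x y"
  define D where "D = (\<Sum>s\<in>UNIV. dsqnorm a x y s * y $ s)"
  define B where "B = (\<lambda>k. \<Sum>l\<in>UNIV. dform b x k l * y $ l)"
  define h where "h = (\<lambda>i j. a x $ i $ j - v\<^sup>2 * (l i * l j))"
  define p where "p = (\<lambda>i. v * l i + b x $ i)"
  define G where "G = (\<lambda>i. 1/2 * g i + \<alpha> * s i + P * y $ i)"
  have \<alpha>: "\<alpha> > 0" and F: "F > 0"
    unfolding \<alpha>_def F_def using alpha_pos randers_pos x y by auto
 have \<alpha>2: "2 * alpha a x y \<noteq> 0" using alpha_pos[OF x y] by simp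
  have v: "v * \<alpha> = 1" using \<alpha> by (simp add: v_def)
  have q: "sqnorm a x y = \<alpha>\<^sup>2" by (simp add: \<alpha>_def alpha_square[OF x])
  have F_eq: "F = \<alpha> + (\<Sum>i\<in>UNIV. b x $ i * y $ i)" by (simp add: F_def \<alpha>_def randers_def beta_def)
  have ly: "(\<Sum>i\<in>UNIV. l i * y $ i) = \<alpha>\<^sup>2" unfolding l_def q[symmetric] sqnorm_lower ..
  have lg: "(\<Sum>i\<in>UNIV. l i * g i) = 1/2 * D" unfolding l_def g_def D_def by (rule lower_geo[OF x])
  have ls: "(\<Sum>i\<in>UNIV. l i * s i) = 0" unfolding l_def s_def by (rule lower_s_up_0[OF x])
  have PF: "2 * (P * F) = (\<Sum>k\<in>UNIV. B k * y $ k) - (\<Sum>i\<in>UNIV. b x $ i * g i)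
      - 2 * \<alpha> * (\<Sum>i\<in>UNIV. b x $ i * s i)"
    using F unfolding P_def radial_part_def beta_geo F_def[symmetric] B_def g_def s_def \<alpha>_def[symmetric]
    by (simp add: field_simps)
  (* contraction with dF *)
  have pG: "2 * (\<Sum>i\<in>UNIV. p i * G i) = 1/2 * v * D + (\<Sum>k\<in>UNIV. B k * y $ k)"
  proof -
    have "2 * (\<Sum>i\<in>UNIV. p i * G i) = v * (\<Sum>i\<in>UNIV. l i * g i) + 2 * (v * \<alpha>) * (\<Sum>i\<in>UNIV. l i * s i)
        + 2 * v * P * (\<Sum>i\<in>UNIV. l i * y $ i) + (\<Sum>i\<in>UNIV. b x $ i * g i)
        + 2 * \<alpha> * (\<Sum>i\<in>UNIV. b x $ i * s i) + 2 * P * (\<Sum>i\<in>UNIV. b x $ i * y $ i)"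
      unfolding p_def G_def by (simp add: sum_distrib_left algebra_simps sum.distrib)
    also have "\<dots> = 1/2 * v * D + 2 * (P * F) + (\<Sum>i\<in>UNIV. b x $ i * g i)
        + 2 * \<alpha> * (\<Sum>i\<in>UNIV. b x $ i * s i) + 2 * P * \<alpha> * (v * \<alpha> - 1)"
      unfolding lg ls ly F_eq by (simp add: algebra_simps power2_eq_square)
    finally show ?thesis unfolding PF v by simp
  qed
  (* contraction with h, the Hessian of the norm multiplied by the norm *)
  have hG: "2 * (\<Sum>i\<in>UNIV. h j i * G i) =
      (\<Sum>m\<in>UNIV. (\<Sum>k\<in>UNIV. dmetric a x m j k * y $ k) * y $ m) - 1/2 * dsqnorm a x y j
      + \<alpha> * ((\<Sum>m\<in>UNIV. dform b x m j * y $ m) - B j) - 1/2 * v\<^sup>2 * l j * D" for j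
  proof -
    have "2 * (\<Sum>i\<in>UNIV. h j i * G i) = (\<Sum>i\<in>UNIV. a x $ j $ i * g i)
        + 2 * \<alpha> * (\<Sum>i\<in>UNIV. a x $ j $ i * s i) + 2 * P * (\<Sum>i\<in>UNIV. a x $ j $ i * y $ i)
        - v\<^sup>2 * l j * ((\<Sum>i\<in>UNIV. l i * g i) + 2 * \<alpha> * (\<Sum>i\<in>UNIV. l i * s i)
        + 2 * P * (\<Sum>i\<in>UNIV. l i * y $ i))"
      unfolding h_def G_def by (simp add: sum_distrib_left algebra_simps sum.distrib sum_subtractf)
    also have "(\<Sum>i\<in>UNIV. a x $ j $ i * y $ i) = l j" by (simp add: l_def lower_def)
    also have "2 * \<alpha> * (\<Sum>i\<in>UNIV. a x $ j $ i * s i) =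
        \<alpha> * ((\<Sum>m\<in>UNIV. dform b x m j * y $ m) - B j)"
      unfolding s_def a_s_up_0[OF x] s_low_eq[OF x] B_def
      by (simp add: sum_distrib_left sum_subtractf[symmetric] algebra_simps)
    also have "(\<Sum>i\<in>UNIV. a x $ j $ i * g i) =
        (\<Sum>m\<in>UNIV. (\<Sum>k\<in>UNIV. dmetric a x m j k * y $ k) * y $ m) - 1/2 * dsqnorm a x y j"
      unfolding g_def by (rule a_geo[OF x])
    finally have "2 * (\<Sum>i\<in>UNIV. h j i * G i) =
        (\<Sum>m\<in>UNIV. (\<Sum>k\<in>UNIV. dmetric a x m j k * y $ k) * y $ m) - 1/2 * dsqnorm a x y j
        + \<alpha> * ((\<Sum>m\<in>UNIV. dform b x m j * y $ m) - B j) - 1/2 * v\<^sup>2 * l j * D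
        + 2 * P * l j * (1 - (v * \<alpha>)\<^sup>2)"
      unfolding lg ls ly by (simp add: algebra_simps power_mult_distrib)
    then show ?thesis unfolding v by simp
  qed
  have "finsler_spray (randers a b) x y = (\<chi> i. G i)"
  proof (rule finsler_spray_eqI[OF det_fundamental_tensor_randers[OF x y]])
    fix j
    have ft: "fundamental_tensor (randers a b) x y $ j $ i = p j * p i + F * v * h j i" for i
      unfolding fundamental_tensor_randers[OF x y] q p_def h_def l_def \<alpha>_def[symmetric] F_def[symmetric] v_def
      by (simp add: power_divide)
    have dxF: "dx k (\<lambda>x y. (randers a b x y)\<^sup>2) x y = 2 * F * (1/2 * v * dsqnorm a x y k + B k)" for k
      unfolding dx_randers_square[OF x y] F_def B_def v_def \<alpha>_def by simp
    have dydxF: "dy j (dx k (\<lambda>x y. (randers a b x y)\<^sup>2)) x y =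
        2 * (p j * (1/2 * v * dsqnorm a x y k + B k)
        + F * (v * (\<Sum>m\<in>UNIV. dmetric a x k j m * y $ m) - 1/2 * v\<^sup>2 * v * l j * dsqnorm a x y k
          + dform b x k j))" for k
    proof -
      have "dy j (dx k (\<lambda>x y. (randers a b x y)\<^sup>2)) x y =
          pd j (\<lambda>y. 2 * (randers a b x y *
            (dsqnorm a x y k / (2 * alpha a x y) + (\<Sum>l\<in>UNIV. dform b x k l * y $ l)))) y"
        unfolding dy_def[of j]
        by (rule pd_cong[OF open_nonzero]) (use x y in \<open>auto simp: dx_randers_square\<close>)
      also have "\<dots> = 2 * ((lower a x y j / alpha a x y + b x $ j) *
            (dsqnorm a x y k / (2 * alpha a x y) + (\<Sum>l\<in>UNIV. dform b x k l * y $ l))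
          + randers a b x y * ((2 * (\<Sum>m\<in>UNIV. dmetric a x k j m * y $ m) * (2 * alpha a x y)
              - dsqnorm a x y k * (2 * (lower a x y j / alpha a x y))) / (2 * alpha a x y)\<^sup>2
            + dform b x k j))"
        by (rule has_pd_imp_pd, rule has_pd_eq,
            (rule pd_intros has_pd_randers_y has_pd_dsqnorm has_pd_alpha_y x y \<alpha>2)+)
          (simp add: mult_delta_right)
      also have "\<dots> = 2 * (p j * (1/2 * v * dsqnorm a x y k + B k)
        + F * (v * (\<Sum>m\<in>UNIV. dmetric a x k j m * y $ m) - 1/2 * v\<^sup>2 * v * l j * dsqnorm a x y k
          + dform b x k j))"
        using \<alpha> unfolding p_def B_def F_def[symmetric] \<alpha>_def[symmetric] l_def v_def
        by (simp add: power2_eq_square field_simps)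
      finally show ?thesis .
    qed
    have "(\<Sum>k\<in>UNIV. dy j (dx k (\<lambda>x y. (randers a b x y)\<^sup>2)) x y * y $ k) =
        2 * (p j * (1/2 * v * D + (\<Sum>k\<in>UNIV. B k * y $ k))
        + F * (v * (\<Sum>k\<in>UNIV. (\<Sum>m\<in>UNIV. dmetric a x k j m * y $ m) * y $ k)
          - 1/2 * v\<^sup>2 * v * l j * D + (\<Sum>k\<in>UNIV. dform b x k j * y $ k)))"
      unfolding dydxF D_def
      by (simp add: sum_distrib_left algebra_simps sum.distrib sum_subtractf)
    then have "1/4 * ((\<Sum>k\<in>UNIV. dy j (dx k (\<lambda>x y. (randers a b x y)\<^sup>2)) x y * y $ k)
        - dx j (\<lambda>x y. (randers a b x y)\<^sup>2) x y) =
        1/2 * (p j * (1/2 * v * D + (\<Sum>k\<in>UNIV. B k * y $ k)))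
        + 1/2 * F * (v * (\<Sum>k\<in>UNIV. (\<Sum>m\<in>UNIV. dmetric a x k j m * y $ m) * y $ k)
          - 1/2 * v\<^sup>2 * v * l j * D + (\<Sum>k\<in>UNIV. dform b x k j * y $ k)
          - 1/2 * v * dsqnorm a x y j - B j)"
      unfolding dxF by (simp add: algebra_simps)
    also have "\<dots> = p j * (\<Sum>i\<in>UNIV. p i * G i) + F * v * (\<Sum>i\<in>UNIV. h j i * G i)
        + 1/2 * F * (1 - v * \<alpha>) * ((\<Sum>k\<in>UNIV. dform b x k j * y $ k) - B j)"
    proof -
      have pG': "(\<Sum>i\<in>UNIV. p i * G i) = 1/2 * (1/2 * v * D + (\<Sum>k\<in>UNIV. B k * y $ k))"
        using pG by simp
      have hG': "(\<Sum>i\<in>UNIV. h j i * G i) =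
          1/2 * ((\<Sum>m\<in>UNIV. (\<Sum>k\<in>UNIV. dmetric a x m j k * y $ k) * y $ m) - 1/2 * dsqnorm a x y j
          + \<alpha> * ((\<Sum>m\<in>UNIV. dform b x m j * y $ m) - B j) - 1/2 * v\<^sup>2 * l j * D)"
        using hG[of j] by simp
      show ?thesis unfolding pG' hG' by (simp add: field_simps)
    qed
    also have "\<dots> = (\<Sum>i\<in>UNIV. fundamental_tensor (randers a b) x y $ j $ i * (\<chi> i. G i) $ i)"
      unfolding ft v by (simp add: distrib_right sum.distrib sum_distrib_left mult.assoc)
    finally show "(\<Sum>i\<in>UNIV. fundamental_tensor (randers a b) x y $ j $ i * (\<chi> i. G i) $ i) =
      1/4 * ((\<Sum>k\<in>UNIV. dy j (dx k (\<lambda>x y. (randers a b x y)\<^sup>2)) x y * y $ k)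
        - dx j (\<lambda>x y. (randers a b x y)\<^sup>2) x y)" by (rule sym)
  qed
  then show ?thesis by (simp add: G_def g_def s_def \<alpha>_def P_def)
qed

end

section \<open>The projective spray of a Randers metric\<close>

context randers_chart
begin

lemma alpha_scale: "t > 0 \<Longrightarrow> alpha a x (t *\<^sub>R y) = t * alpha a x y"
proof -
  assume t: "t > 0"
  have "sqnorm a x (t *\<^sub>R y) = t\<^sup>2 * sqnorm a x y"
    unfolding sqnorm_def by (simp add: sum_distrib_left power2_eq_square mult_ac)
  then show ?thesis using t by (simp add: alpha_eq real_sqrt_mult)
qed

lemma radial_part_scale:
  assumes t: "t > 0"
  shows "radial_part a b x (t *\<^sub>R y) = t * radial_part a b x y"
proof -
  define r where "r = (\<lambda>y. \<Sum>i\<in>UNIV. \<Sum>j\<in>UNIV. cov_form a b x i j * y $ i * y $ j)"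
  define s where "s = (\<lambda>y. \<Sum>i\<in>UNIV. b x $ i * s_up_0 a b x y i)"
  have "r (t *\<^sub>R y) = t * (t * r y)"
    unfolding r_def by (simp add: sum_distrib_left mult_ac)
  moreover have "s (t *\<^sub>R y) = t * s y"
    unfolding s_def s_up_0_def by (simp add: sum_distrib_left mult_ac)
  moreover have "randers a b x (t *\<^sub>R y) = t * randers a b x y"
    unfolding randers_def alpha_scale[OF t] beta_def by (simp add: sum_distrib_left algebra_simps)
  moreover have "radial_part a b x y = (r y - 2 * alpha a x y * s y) / (2 * randers a b x y)" for y
    by (simp add: radial_part_def r_def s_def)
  ultimately have "radial_part a b x (t *\<^sub>R y) =
      (t * (t * (r y - 2 * alpha a x y * s y))) / (t * (2 * randers a b x y))"
    by (simp add: alpha_scale[OF t] algebra_simps)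
  then show ?thesis
    using t by (simp add: radial_part_def r_def s_def)
qed

lemma differentiable_component: "(\<lambda>y :: real ^ 'n. y $ i) differentiable (at y)"
  by (intro bounded_linear_imp_differentiable bounded_linear_vec_nth)

lemma differentiable_radial_part:
  assumes "x \<in> U" "y \<noteq> 0"
  shows "radial_part a b x differentiable (at y)"
proof -
  have "sqrt differentiable (at (sqnorm a x y))"
    using DERIV_real_sqrt[OF sqnorm_pos[OF assms]]
    unfolding has_field_derivative_def differentiable_def by blast
  moreover have "sqnorm a x differentiable (at y)"
    unfolding sqnorm_def by (simp add: differentiable_component)
  ultimately have "(\<lambda>y. alpha a x y) differentiable (at y)"
    unfolding alpha_eq using differentiable_chain_at[of "sqnorm a x" y sqrt] by (simp add: o_def)
  then show ?thesis
    using randers_pos[OF assms]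
    unfolding radial_part_def randers_def beta_def s_up_0_def
    by (simp add: differentiable_component)
qed

lemma Euler_radial_part:
  assumes "x \<in> U" "y \<noteq> 0"
  shows "(\<Sum>m\<in>UNIV. pd m (radial_part a b x) y * y $ m) = radial_part a b x y"
  by (intro Euler_homogeneous differentiable_radial_part radial_part_scale assms)

lemma has_pd_s_up_0_y: "has_pd j (\<lambda>y. s_up_0 a b x y i) (s_mix a b x i j) y"
  unfolding s_up_0_def by (rule has_pd_eq, (assumption | rule pd_intros)+) (simp add: mult_delta_right)

lemma has_pd_s_up_0_x:
  "x \<in> U \<Longrightarrow> has_pd k (\<lambda>x. s_up_0 a b x y i) (\<Sum>j\<in>UNIV. pd k (\<lambda>x. s_mix a b x i j) x * y $ j) x"
  unfolding s_up_0_def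
  by (rule has_pd_eq, (assumption | rule pd_intros smooth_on_has_pd[OF smooth_s_mix])+) simp

text \<open>The field \<open>\<alpha> s\<^sup>i\<^sub>0\<close> has no divergence in \<open>y\<close>, so the S-curvature only sees \<open>\<alpha>\<close>, the volume form
  and the radial part.\<close>

lemma S_curvature_randers:
  assumes x: "x \<in> U" and y: "y \<noteq> 0"
  shows "S_curvature (finsler_spray (randers a b)) \<sigma> x y =
    (\<Sum>k\<in>UNIV. (\<Sum>m\<in>UNIV. christoffel a x m m k) * y $ k)
    + (real CARD('n) + 1) * radial_part a b x y - (\<Sum>m\<in>UNIV. y $ m * pd m (\<lambda>x. ln (\<sigma> x)) x)"
proof -
  have D: "dy m (\<lambda>x y. finsler_spray (randers a b) x y $ m) x y =
      conn a x y m m + 1 / alpha a x y * (lower a x y m * s_up_0 a b x y m) + alpha a x y * s_mix a b x m m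
      + pd m (radial_part a b x) y * y $ m + radial_part a b x y" for m
  proof -
    have "dy m (\<lambda>x y. finsler_spray (randers a b) x y $ m) x y =
        pd m (\<lambda>y. 1/2 * geo a x y m + alpha a x y * s_up_0 a b x y m + radial_part a b x y * y $ m) y"
      unfolding dy_def by (rule pd_cong[OF open_nonzero]) (use x y finsler_spray_randers in auto)
    also have "\<dots> = conn a x y m m + 1 / alpha a x y * (lower a x y m * s_up_0 a b x y m)
        + alpha a x y * s_mix a b x m m + pd m (radial_part a b x) y * y $ m + radial_part a b x y"
      by (rule has_pd_imp_pd, rule has_pd_eq,
          (rule pd_intros has_pd_geo_y has_pd_alpha_y has_pd_s_up_0_y
            differentiable_has_pd[OF differentiable_radial_part] x y)+) simp
    finally show ?thesis .
  qed
  show ?thesis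
    using Euler_radial_part[OF x y] unfolding S_curvature_def D
    by (simp add: sum.distrib trace_conn lower_s_up_0[OF x] trace_s_mix[OF x]
        algebra_simps flip: sum_distrib_left sum_divide_distrib)
qed

text \<open>In passing to the projective spray the radial part cancels; what remains along \<open>y\<close> is the
  differential of the logarithmic ratio of the Riemannian volume and the given one.\<close>

lemma projective_spray_randers:
  assumes x: "x \<in> U" and y: "y \<noteq> 0"
    and \<sigma>: "smooth_on U \<sigma>" "\<And>x. x \<in> U \<Longrightarrow> \<sigma> x > 0"
    and f: "\<And>x. x \<in> U \<Longrightarrow> f x = (1/4 * ln ((det (a x))\<^sup>2) - ln (\<sigma> x)) / (real CARD('n) + 1)"
  shows "projective_spray (finsler_spray (randers a b)) \<sigma> x y $ i =
    1/2 * geo a x y i + alpha a x y * s_up_0 a b x y i - grad_0 f x y * y $ i"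
proof -
  define c where "c = real CARD('n) + 1"
  have c: "c \<noteq> 0" unfolding c_def by linarith
  have pd_f: "pd k f x = ((\<Sum>m\<in>UNIV. christoffel a x m m k) - pd k (\<lambda>x. ln (\<sigma> x)) x) / c" for k
  proof -
    have "pd k f x = pd k (\<lambda>x. (1/4 * ln ((det (a x))\<^sup>2) - ln (\<sigma> x)) / c) x"
      unfolding c_def by (rule pd_cong[OF open_U x f])
    also have "\<dots> = (((\<Sum>m\<in>UNIV. christoffel a x m m k) - pd k (\<lambda>x. ln (\<sigma> x)) x) * c
        - (1/4 * ln ((det (a x))\<^sup>2) - ln (\<sigma> x)) * 0) / c\<^sup>2"
      by (intro has_pd_imp_pd pd_intros trace_christoffel x c
          smooth_on_has_pd[OF smooth_on_ln[OF open_U \<sigma>] x])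
    finally show ?thesis using c by (simp add: power2_eq_square)
  qed
  have "c * grad_0 f x y = (\<Sum>k\<in>UNIV. (c * pd k f x) * y $ k)"
    by (simp add: grad_0_def sum_distrib_left mult.assoc)
  also have "\<dots> = (\<Sum>k\<in>UNIV. ((\<Sum>m\<in>UNIV. christoffel a x m m k) - pd k (\<lambda>x. ln (\<sigma> x)) x) * y $ k)"
    using c by (simp add: pd_f)
  also have "\<dots> = (\<Sum>k\<in>UNIV. (\<Sum>m\<in>UNIV. christoffel a x m m k) * y $ k)
      - (\<Sum>m\<in>UNIV. y $ m * pd m (\<lambda>x. ln (\<sigma> x)) x)"
    by (simp add: left_diff_distrib sum_subtractf mult.commute[of "y $ _"])
  finally have "c * grad_0 f x y = (\<Sum>k\<in>UNIV. (\<Sum>m\<in>UNIV. christoffel a x m m k) * y $ k)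
      - (\<Sum>m\<in>UNIV. y $ m * pd m (\<lambda>x. ln (\<sigma> x)) x)" .
  then have "S_curvature (finsler_spray (randers a b)) \<sigma> x y = c * (grad_0 f x y + radial_part a b x y)"
    unfolding S_curvature_randers[OF x y] c_def[symmetric] by (simp add: algebra_simps)
  then have "S_curvature (finsler_spray (randers a b)) \<sigma> x y / c = grad_0 f x y + radial_part a b x y"
    using c by simp
  then show ?thesis
    unfolding projective_spray_def c_def[symmetric]
    by (simp add: finsler_spray_randers[OF x y] algebra_simps)
qed

end

section \<open>The Ricci curvature of the projective spray\<close>

text \<open>The quadratic term of the Ricci curvature is the trace of the square of
  \<open>\<partial>G\<^sup>m/\<partial>y\<^sup>s\<close>, which has a Riemannian part, a part \<open>Z\<close> from \<open>\<alpha> s\<^sup>m\<^sub>0\<close> and a part \<open>W\<close> from \<open>h\<^sub>0 y\<^sup>m\<close>.\<close>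

lemma trace_square_expand:
  fixes C Z W :: "'n::finite \<Rightarrow> 'n \<Rightarrow> real"
  shows "(\<Sum>m\<in>UNIV. \<Sum>s\<in>UNIV. (C m s + Z m s - W m s) * (C s m + Z s m - W s m)) =
    (\<Sum>m\<in>UNIV. \<Sum>s\<in>UNIV. C m s * C s m) + (\<Sum>m\<in>UNIV. \<Sum>s\<in>UNIV. Z m s * Z s m)
    + (\<Sum>m\<in>UNIV. \<Sum>s\<in>UNIV. W m s * W s m) + 2 * (\<Sum>m\<in>UNIV. \<Sum>s\<in>UNIV. C m s * Z s m)
    - 2 * (\<Sum>m\<in>UNIV. \<Sum>s\<in>UNIV. C m s * W s m) - 2 * (\<Sum>m\<in>UNIV. \<Sum>s\<in>UNIV. Z m s * W s m)"
proof -
  have swap: "(\<Sum>m\<in>UNIV. \<Sum>s\<in>UNIV. X m s * Y s m) = (\<Sum>m\<in>UNIV. \<Sum>s\<in>UNIV. Y m s * X s m)"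
    for X Y :: "'n \<Rightarrow> 'n \<Rightarrow> real"
    by (subst sum.swap) (simp add: mult.commute)
  have "(\<Sum>m\<in>UNIV. \<Sum>s\<in>UNIV. (C m s + Z m s - W m s) * (C s m + Z s m - W s m)) =
    (\<Sum>m\<in>UNIV. \<Sum>s\<in>UNIV. C m s * C s m) + (\<Sum>m\<in>UNIV. \<Sum>s\<in>UNIV. Z m s * Z s m)
    + (\<Sum>m\<in>UNIV. \<Sum>s\<in>UNIV. W m s * W s m)
    + ((\<Sum>m\<in>UNIV. \<Sum>s\<in>UNIV. C m s * Z s m) + (\<Sum>m\<in>UNIV. \<Sum>s\<in>UNIV. Z m s * C s m))
    - ((\<Sum>m\<in>UNIV. \<Sum>s\<in>UNIV. C m s * W s m) + (\<Sum>m\<in>UNIV. \<Sum>s\<in>UNIV. W m s * C s m))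
    - ((\<Sum>m\<in>UNIV. \<Sum>s\<in>UNIV. Z m s * W s m) + (\<Sum>m\<in>UNIV. \<Sum>s\<in>UNIV. W m s * Z s m))"
    by (simp add: distrib_left distrib_right left_diff_distrib right_diff_distrib
        sum.distrib sum_subtractf)
  then show ?thesis by (simp add: swap[of Z C] swap[of W C] swap[of W Z])
qed

context randers_chart
begin

lemma div_s_0_eq:
  assumes x: "x \<in> U"
  shows "div_s_0 a b x y = (\<Sum>m\<in>UNIV. \<Sum>j\<in>UNIV. pd m (\<lambda>x. s_mix a b x m j) x * y $ j)
    + (\<Sum>k\<in>UNIV. (\<Sum>m\<in>UNIV. christoffel a x m m k) * s_up_0 a b x y k)
    - (\<Sum>m\<in>UNIV. \<Sum>k\<in>UNIV. conn a x y m k * s_mix a b x k m)"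
proof -
  have 1: "(\<Sum>m\<in>UNIV. \<Sum>j\<in>UNIV. \<Sum>k\<in>UNIV. christoffel a x m k m * s_mix a b x k j * y $ j) =
      (\<Sum>k\<in>UNIV. (\<Sum>m\<in>UNIV. christoffel a x m m k) * s_up_0 a b x y k)"
  proof -
    have "(\<Sum>m\<in>UNIV. \<Sum>j\<in>UNIV. \<Sum>k\<in>UNIV. christoffel a x m k m * s_mix a b x k j * y $ j) =
        (\<Sum>m\<in>UNIV. \<Sum>k\<in>UNIV. christoffel a x m m k * s_up_0 a b x y k)"
      unfolding s_up_0_def sum_distrib_left
      by (rule sum.cong[OF refl], subst sum.swap) (simp add: christoffel_sym[OF x, of m _ m for m] mult.assoc)
    also have "\<dots> = (\<Sum>k\<in>UNIV. (\<Sum>m\<in>UNIV. christoffel a x m m k) * s_up_0 a b x y k)"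
      unfolding sum_distrib_right by (rule sum.swap)
    finally show ?thesis .
  qed
  have 2: "(\<Sum>m\<in>UNIV. \<Sum>j\<in>UNIV. \<Sum>k\<in>UNIV. christoffel a x k j m * s_mix a b x m k * y $ j) =
      (\<Sum>m\<in>UNIV. \<Sum>k\<in>UNIV. conn a x y m k * s_mix a b x k m)"
  proof -
    have "(\<Sum>m\<in>UNIV. \<Sum>j\<in>UNIV. \<Sum>k\<in>UNIV. christoffel a x k j m * s_mix a b x m k * y $ j) =
        (\<Sum>m\<in>UNIV. \<Sum>k\<in>UNIV. conn a x y k m * s_mix a b x m k)"
      unfolding conn_def sum_distrib_right
      by (rule sum.cong[OF refl], subst sum.swap, intro sum.cong refl)
        (simp add: christoffel_sym[OF x, of _ _ m for m] mult_ac)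
    also have "\<dots> = (\<Sum>m\<in>UNIV. \<Sum>k\<in>UNIV. conn a x y m k * s_mix a b x k m)"
      by (rule sum.swap)
    finally show ?thesis .
  qed
  show ?thesis
    unfolding div_s_0_def cov_s_mix_def 1[symmetric] 2[symmetric]
    by (simp add: distrib_right left_diff_distrib sum.distrib sum_subtractf sum_distrib_right)
qed

lemma hess_00_eq:
  "hess_00 a f x y = (\<Sum>j\<in>UNIV. y $ j * (\<Sum>k\<in>UNIV. pd j (pd k f) x * y $ k)) - (\<Sum>k\<in>UNIV. pd k f x * geo a x y k)"
proof -
  have "hess_00 a f x y = (\<Sum>i\<in>UNIV. \<Sum>j\<in>UNIV. pd j (pd i f) x * y $ i * y $ j)
      - (\<Sum>i\<in>UNIV. \<Sum>j\<in>UNIV. \<Sum>k\<in>UNIV. christoffel a x k i j * pd k f x * y $ i * y $ j)"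
    unfolding hess_00_def cov_form_def
    by (simp add: left_diff_distrib sum_subtractf sum_distrib_right)
  also have "(\<Sum>i\<in>UNIV. \<Sum>j\<in>UNIV. pd j (pd i f) x * y $ i * y $ j) =
      (\<Sum>j\<in>UNIV. y $ j * (\<Sum>k\<in>UNIV. pd j (pd k f) x * y $ k))"
    by (subst sum.swap) (simp add: sum_distrib_left mult_ac)
  also have "(\<Sum>i\<in>UNIV. \<Sum>j\<in>UNIV. \<Sum>k\<in>UNIV. christoffel a x k i j * pd k f x * y $ i * y $ j) =
      (\<Sum>k\<in>UNIV. \<Sum>i\<in>UNIV. \<Sum>j\<in>UNIV. christoffel a x k i j * pd k f x * y $ i * y $ j)"
    by (subst sum.swap[of _ UNIV UNIV, symmetric], rule sum.cong[OF refl], rule sum.swap)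
  also have "\<dots> = (\<Sum>k\<in>UNIV. pd k f x * geo a x y k)"
    unfolding geo_def conn_def by (simp add: sum_distrib_left sum_distrib_right mult_ac)
  finally show ?thesis .
qed


lemma has_pd_grad_0_y: "has_pd j (\<lambda>y. grad_0 f x y) (pd j f x) y"
  unfolding grad_0_def by (rule has_pd_eq, (assumption | rule pd_intros)+) (simp add: mult_delta_right)

lemma has_pd_grad_0_x:
  assumes "x \<in> U" "smooth_on U f"
  shows "has_pd j (\<lambda>x. grad_0 f x y) (\<Sum>k\<in>UNIV. pd j (pd k f) x * y $ k) x"
  unfolding grad_0_def
  by (rule has_pd_eq, (assumption |
        rule pd_intros smooth_on_has_pd[OF smooth_on_pd[OF open_U assms(2)] assms(1)])+) simp

lemma has_pd_lower_x: "x \<in> U \<Longrightarrow> has_pd k (\<lambda>x. lower a x y l) (\<Sum>j\<in>UNIV. dmetric a x k l j * y $ j) x"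
  unfolding lower_def by (rule has_pd_eq, (assumption | rule pd_intros has_pd_a)+) simp

text \<open>The first summand on the right cancels against the derivative of \<open>\<alpha>\<close> in \<open>\<partial>G\<^sup>m/\<partial>x\<^sup>m\<close>, and the second
  belongs to \<open>s\<^sup>m\<^sub>0\<^sub>;\<^sub>m\<close>.\<close>

lemma trace_conn_Z:
  assumes x: "x \<in> U"
  shows "(\<Sum>m\<in>UNIV. \<Sum>s\<in>UNIV. conn a x y m s *
      (v * lower a x y m * s_up_0 a b x y s + \<alpha> * s_mix a b x s m)) =
    1/2 * v * (\<Sum>m\<in>UNIV. dsqnorm a x y m * s_up_0 a b x y m)
    + \<alpha> * (\<Sum>m\<in>UNIV. \<Sum>s\<in>UNIV. conn a x y m s * s_mix a b x s m)"
proof -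
  have "(\<Sum>m\<in>UNIV. \<Sum>s\<in>UNIV. conn a x y m s * (lower a x y m * s_up_0 a b x y s)) =
      (\<Sum>s\<in>UNIV. (\<Sum>m\<in>UNIV. lower a x y m * conn a x y m s) * s_up_0 a b x y s)"
    unfolding sum_distrib_right by (subst sum.swap) (simp add: mult_ac)
  also have "\<dots> = 1/2 * (\<Sum>m\<in>UNIV. dsqnorm a x y m * s_up_0 a b x y m)"
    unfolding lower_conn[OF x] by (simp add: sum_distrib_left)
  finally have L: "(\<Sum>m\<in>UNIV. \<Sum>s\<in>UNIV. conn a x y m s * (lower a x y m * s_up_0 a b x y s)) =
      1/2 * (\<Sum>m\<in>UNIV. dsqnorm a x y m * s_up_0 a b x y m)" .
  have "(\<Sum>m\<in>UNIV. \<Sum>s\<in>UNIV. conn a x y m s *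
      (v * lower a x y m * s_up_0 a b x y s + \<alpha> * s_mix a b x s m)) =
    v * (\<Sum>m\<in>UNIV. \<Sum>s\<in>UNIV. conn a x y m s * (lower a x y m * s_up_0 a b x y s))
    + \<alpha> * (\<Sum>m\<in>UNIV. \<Sum>s\<in>UNIV. conn a x y m s * s_mix a b x s m)"
    by (simp add: distrib_left sum.distrib sum_distrib_left mult_ac)
  then show ?thesis by (simp add: L)
qed

text \<open>The square of the rank one part vanishes as \<open>s\<^sub>0\<^sub>0 = 0\<close>; the two mixed terms agree.\<close>

lemma trace_Z_Z:
  assumes x: "x \<in> U" and v: "v * \<alpha> = 1"
  shows "(\<Sum>m\<in>UNIV. \<Sum>s\<in>UNIV. (v * lower a x y s * s_up_0 a b x y m + \<alpha> * s_mix a b x m s) *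
      (v * lower a x y m * s_up_0 a b x y s + \<alpha> * s_mix a b x s m)) =
    2 * (\<Sum>m\<in>UNIV. s_low_0 a b x y m * s_up_0 a b x y m)
    + \<alpha>\<^sup>2 * (\<Sum>m\<in>UNIV. \<Sum>s\<in>UNIV. s_mix a b x m s * s_mix a b x s m)"
proof -
  let ?l = "lower a x y" and ?u = "s_up_0 a b x y" and ?s = "s_mix a b x"
  have 1: "(\<Sum>m\<in>UNIV. \<Sum>s\<in>UNIV. (?l m * ?u m) * (?l s * ?u s)) = 0"
    unfolding sum_product[symmetric] lower_s_up_0[OF x] by simp
  have 2: "(\<Sum>m\<in>UNIV. \<Sum>s\<in>UNIV. ?u s * (?l m * ?s m s)) = (\<Sum>m\<in>UNIV. s_low_0 a b x y m * ?u m)"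
    by (subst sum.swap) (simp add: lower_s_mix[OF x] mult.commute flip: sum_distrib_left)
  have 3: "(\<Sum>m\<in>UNIV. \<Sum>s\<in>UNIV. ?u m * (?l s * ?s s m)) = (\<Sum>m\<in>UNIV. s_low_0 a b x y m * ?u m)"
    by (simp add: lower_s_mix[OF x] mult.commute flip: sum_distrib_left)
  have "(\<Sum>m\<in>UNIV. \<Sum>s\<in>UNIV. (v * ?l s * ?u m + \<alpha> * ?s m s) * (v * ?l m * ?u s + \<alpha> * ?s s m)) =
      (\<Sum>m\<in>UNIV. \<Sum>s\<in>UNIV. v\<^sup>2 * ((?l m * ?u m) * (?l s * ?u s))
        + (v * \<alpha>) * (?u s * (?l m * ?s m s)) + (v * \<alpha>) * (?u m * (?l s * ?s s m))
        + \<alpha>\<^sup>2 * (?s m s * ?s s m))"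
    by (intro sum.cong refl) (simp add: algebra_simps power2_eq_square)
  also have "\<dots> = v\<^sup>2 * (\<Sum>m\<in>UNIV. \<Sum>s\<in>UNIV. (?l m * ?u m) * (?l s * ?u s))
        + (\<Sum>m\<in>UNIV. \<Sum>s\<in>UNIV. ?u s * (?l m * ?s m s)) + (\<Sum>m\<in>UNIV. \<Sum>s\<in>UNIV. ?u m * (?l s * ?s s m))
        + \<alpha>\<^sup>2 * (\<Sum>m\<in>UNIV. \<Sum>s\<in>UNIV. ?s m s * ?s s m)"
    unfolding v by (simp add: sum.distrib sum_distrib_left)
  finally show ?thesis unfolding 1 2 3 by simp
qed

lemma trace_conn_W:
  "(\<Sum>m\<in>UNIV. \<Sum>s\<in>UNIV. conn a x y m s * (d m * y $ s + g * (if m = s then 1 else 0))) =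
    (\<Sum>m\<in>UNIV. d m * geo a x y m) + g * (\<Sum>m\<in>UNIV. conn a x y m m)"
proof -
  have "(\<Sum>s\<in>UNIV. conn a x y m s * (d m * y $ s + g * (if m = s then 1 else 0))) =
      d m * geo a x y m + g * conn a x y m m" for m
    unfolding geo_def by (simp add: distrib_left sum.distrib sum_distrib_left mult_delta_right mult_ac)
  then show ?thesis by (simp add: sum.distrib sum_distrib_left)
qed

lemma trace_Z_W:
  assumes x: "x \<in> U" and v: "v * \<alpha> = 1" and q: "sqnorm a x y = \<alpha>\<^sup>2"
  shows "(\<Sum>m\<in>UNIV. \<Sum>s\<in>UNIV. (v * lower a x y s * s_up_0 a b x y m + \<alpha> * s_mix a b x m s) *
      (d m * y $ s + g * (if m = s then 1 else 0))) =
    2 * \<alpha> * (\<Sum>m\<in>UNIV. d m * s_up_0 a b x y m)"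
proof -
  let ?l = "lower a x y" and ?u = "s_up_0 a b x y" and ?s = "s_mix a b x"
  have "(\<Sum>s\<in>UNIV. (v * ?l s * ?u m + \<alpha> * ?s m s) * (d m * y $ s + g * (if m = s then 1 else 0))) =
      v * (d m * ?u m) * (\<Sum>s\<in>UNIV. ?l s * y $ s) + \<alpha> * d m * (\<Sum>s\<in>UNIV. ?s m s * y $ s)
      + g * v * (?l m * ?u m) + g * \<alpha> * ?s m m" for m
    by (simp add: distrib_left distrib_right sum.distrib sum_distrib_left mult_delta_right mult_ac)
  also have "\<dots> m = (v * \<alpha>) * \<alpha> * (d m * ?u m) + \<alpha> * (d m * ?u m) + g * v * (?l m * ?u m) + g * \<alpha> * ?s m m" for m
    unfolding sqnorm_lower[symmetric] q s_up_0_def[symmetric] by (simp add: power2_eq_square)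
  finally have "(\<Sum>s\<in>UNIV. (v * ?l s * ?u m + \<alpha> * ?s m s) * (d m * y $ s + g * (if m = s then 1 else 0))) =
      2 * \<alpha> * (d m * ?u m) + g * v * (?l m * ?u m) + g * \<alpha> * ?s m m" for m
    by (simp add: v)
  then show ?thesis
    using lower_s_up_0[OF x, of y] trace_s_mix[OF x]
    by (simp add: sum.distrib flip: sum_distrib_left)
qed

lemma trace_W_W:
  fixes d :: "'n \<Rightarrow> real"
  assumes g: "g = (\<Sum>m\<in>UNIV. d m * y $ m)"
  shows "(\<Sum>m\<in>UNIV. \<Sum>s\<in>UNIV. (d s * y $ m + g * (if s = m then 1 else 0)) *
      (d m * y $ s + g * (if m = s then 1 else 0))) = (real CARD('n) + 3) * g\<^sup>2"
proof -
  have "(\<Sum>s\<in>UNIV. (d s * y $ m + g * (if s = m then 1 else 0)) * (d m * y $ s + g * (if m = s then 1 else 0))) =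
      (\<Sum>s\<in>UNIV. d s * y $ s) * (d m * y $ m) + 2 * g * (d m * y $ m) + g * g" for m
  proof -
    have "(d s * y $ m + g * (if s = m then 1 else 0)) * (d m * y $ s + g * (if m = s then 1 else 0)) =
        (d s * y $ s) * (d m * y $ m) + (if m = s then 2 * g * (d m * y $ m) + g * g else 0)" for s
      by (simp add: algebra_simps)
    then show ?thesis by (simp add: sum.distrib sum_distrib_right)
  qed
  then show ?thesis
    by (simp only: g[symmetric] sum.distrib sum_distrib_left[symmetric] sum_constant)
      (simp add: algebra_simps power2_eq_square)
qed


text \<open>Derivatives of \<open>\<alpha>\<close> and of the Christoffel symbols combine to covariant derivatives: the first
  partial derivatives of \<open>\<alpha>\<close> cancel by metric compatibility, and the terms with \<open>\<alpha> \<partial>s\<close> are completed to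
  \<open>2 \<alpha> s\<^sup>m\<^sub>0\<^sub>;\<^sub>m\<close>, those with second derivatives of \<open>f\<close> to its Hessian. Each coefficient \<open>n - 1\<close> is
  \<open>n + 1\<close>, the factor of \<open>df\<close> in the divergence, corrected by the terms without divergence.\<close>

lemma Ric_projective:
  fixes G :: "'n spray"
  assumes x: "x \<in> U" and y: "y \<noteq> 0" and f: "smooth_on U f"
    and G: "\<And>x y i. x \<in> U \<Longrightarrow> y \<noteq> 0 \<Longrightarrow> G x y $ i =
      1/2 * geo a x y i + alpha a x y * s_up_0 a b x y i - grad_0 f x y * y $ i"
  shows "Ric G x y = Ric (finsler_spray (alpha a)) x y
    - 2 * (\<Sum>m\<in>UNIV. s_low_0 a b x y m * s_up_0 a b x y m)
    - sqnorm a x y * (\<Sum>i\<in>UNIV. \<Sum>j\<in>UNIV. s_mix a b x i j * s_mix a b x j i)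
    + (real CARD('n) - 1) * (hess_00 a f x y + (grad_0 f x y)\<^sup>2)
    + 2 * alpha a x y * (div_s_0 a b x y - (real CARD('n) - 1) * (\<Sum>m\<in>UNIV. pd m f x * s_up_0 a b x y m))"
    (is "_ = ?rhs")
proof -
  define n where "n = real CARD('n)"
  define N where "N = (\<lambda>m s x y. conn a x y m s
    + (1 / alpha a x y * lower a x y s * s_up_0 a b x y m + alpha a x y * s_mix a b x m s)
    - (pd s f x * y $ m + grad_0 f x y * (if s = m then 1 else 0)))"
  define \<tau> where "\<tau> = (\<lambda>k x. (\<Sum>m\<in>UNIV. christoffel a x m m k) - (n + 1) * pd k f x)"
  have \<alpha>0: "alpha a x y \<noteq> 0" if "x \<in> U" "y \<noteq> 0" for x y
    using alpha_pos[OF that] by simp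
  have pdf: "has_pd j (pd k f) (pd j (pd k f) x) x" for j k
    by (rule smooth_on_has_pd[OF smooth_on_pd[OF open_U f] x])
  define \<alpha> where "\<alpha> = alpha a x y"
  define v where "v = 1 / \<alpha>"
  define E where "E = (\<lambda>m. 1/2 * (\<Sum>s\<in>UNIV. (\<Sum>k\<in>UNIV. pd m (\<lambda>x. christoffel a x m s k) x * y $ k) * y $ s)
    + (1/2 * v * (dsqnorm a x y m * s_up_0 a b x y m) + \<alpha> * (\<Sum>j\<in>UNIV. pd m (\<lambda>x. s_mix a b x m j) x * y $ j))
    - y $ m * (\<Sum>k\<in>UNIV. pd m (pd k f) x * y $ k))"
  define K where "K = (\<lambda>m x y. 1/2 * geo a x y m + alpha a x y * s_up_0 a b x y m - grad_0 f x y * y $ m)"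
  define \<tau>' where "\<tau>' = (\<lambda>j k. (\<Sum>m\<in>UNIV. pd j (\<lambda>x. christoffel a x m m k) x) - (n + 1) * pd j (pd k f) x)"
  have "Ric G x y = 2 * (\<Sum>m\<in>UNIV. E m) - (\<Sum>j\<in>UNIV. y $ j * (\<Sum>k\<in>UNIV. \<tau>' j k * y $ k))
     + 2 * (\<Sum>j\<in>UNIV. K j x y * \<tau> j x) - (\<Sum>m\<in>UNIV. \<Sum>s\<in>UNIV. N m s x y * N s m x y)"
  proof (rule Ric_of_linear_divergence[OF open_U x open_nonzero])
    show "y \<in> - {0}" using y by simp
    show "G x y $ m = K m x y" if "x \<in> U" "y \<in> - {0}" for x y m
      using G that by (simp add: K_def)
    show "has_pd s (\<lambda>y. K m x y) (N m s x y) y" if "x \<in> U" "y \<in> - {0}" for x y m s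
    proof -
      have y: "y \<noteq> 0" using that(2) by simp
      show ?thesis
        unfolding K_def N_def
        by (rule has_pd_eq, (rule pd_intros has_pd_geo_y has_pd_alpha_y has_pd_s_up_0_y has_pd_grad_0_y
              that(1) y)+) simp
    qed
    show "has_pd m (\<lambda>x. K m x y) (E m) x" for m
      unfolding K_def E_def
      by (rule has_pd_eq, (rule pd_intros has_pd_geo_x has_pd_alpha_x has_pd_s_up_0_x has_pd_grad_0_x x y f)+)
        (simp add: \<alpha>_def v_def)
    show "\<exists>D. has_pd j (\<lambda>x. N m m x y) D x" for m j
      unfolding N_def
      by (rule exI, (rule pd_intros has_pd_conn_x has_pd_alpha_x has_pd_lower_x has_pd_s_up_0_x
            has_pd_grad_0_x smooth_on_has_pd[OF smooth_s_mix] \<alpha>0 x y f pdf)+)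
    show "\<exists>D. has_pd j (\<lambda>y. N m m x y) D y" for m j
      unfolding N_def
      by (rule exI, (rule pd_intros has_pd_conn_y has_pd_alpha_y has_pd_lower has_pd_s_up_0_y
            has_pd_grad_0_y \<alpha>0 x y)+)
    show "(\<Sum>m\<in>UNIV. N m m x y) = (\<Sum>k\<in>UNIV. \<tau> k x * y $ k)" if "x \<in> U" "y \<in> - {0}" for x y
    proof -
      have "(\<Sum>m\<in>UNIV. N m m x y) = (\<Sum>m\<in>UNIV. conn a x y m m)
          + 1 / alpha a x y * (\<Sum>m\<in>UNIV. lower a x y m * s_up_0 a b x y m)
          + alpha a x y * (\<Sum>m\<in>UNIV. s_mix a b x m m) - (n + 1) * grad_0 f x y"
        unfolding N_def n_def
        by (simp add: sum.distrib sum_subtractf sum_distrib_left sum_divide_distrib algebra_simps)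
          (simp add: grad_0_def mult.commute)
      also have "\<dots> = (\<Sum>k\<in>UNIV. \<tau> k x * y $ k)"
        unfolding lower_s_up_0[OF that(1)] trace_s_mix[OF that(1)] trace_conn \<tau>_def grad_0_def
        by (simp add: left_diff_distrib sum_subtractf sum_distrib_left mult.assoc)
      finally show ?thesis .
    qed
    show "has_pd j (\<tau> k) (\<tau>' j k) x" for j k
      unfolding \<tau>_def \<tau>'_def
      by (rule has_pd_eq, (rule pd_intros has_pd_trace_christoffel x pdf)+) simp
  qed
  moreover
  define u where "u = s_up_0 a b x y"
  define d where "d = (\<lambda>k. pd k f x)"
  define g where "g = grad_0 f x y"
  define T where "T = (\<lambda>k. \<Sum>m\<in>UNIV. christoffel a x m m k)"
  define C where "C = (\<lambda>m s. conn a x y m s)"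
  have g: "g = (\<Sum>m\<in>UNIV. d m * y $ m)" by (simp add: g_def d_def grad_0_def)
  have v: "v * \<alpha> = 1" using \<alpha>0[OF x y] by (simp add: v_def \<alpha>_def)
  have q: "sqnorm a x y = \<alpha>\<^sup>2" by (simp add: \<alpha>_def alpha_square[OF x])
  have "(\<Sum>m\<in>UNIV. \<Sum>s\<in>UNIV. N m s x y * N s m x y) =
    (\<Sum>m\<in>UNIV. \<Sum>s\<in>UNIV. C m s * C s m)
    + (2 * (\<Sum>m\<in>UNIV. s_low_0 a b x y m * u m)
      + \<alpha>\<^sup>2 * (\<Sum>m\<in>UNIV. \<Sum>s\<in>UNIV. s_mix a b x m s * s_mix a b x s m))
    + (n + 3) * g\<^sup>2
    + 2 * (1/2 * v * (\<Sum>m\<in>UNIV. dsqnorm a x y m * u m)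
      + \<alpha> * (\<Sum>m\<in>UNIV. \<Sum>s\<in>UNIV. C m s * s_mix a b x s m))
    - 2 * ((\<Sum>m\<in>UNIV. d m * geo a x y m) + g * (\<Sum>m\<in>UNIV. C m m))
    - 2 * (2 * \<alpha> * (\<Sum>m\<in>UNIV. d m * u m))"
    unfolding N_def \<alpha>_def[symmetric] v_def[symmetric] g_def[symmetric] trace_square_expand C_def u_def n_def
    unfolding trace_conn_Z[OF x] trace_Z_Z[OF x v]
    unfolding trace_conn_W trace_Z_W[OF x v q] trace_W_W[OF g[unfolded d_def]] d_def ..
  moreover have "2 * (\<Sum>m\<in>UNIV. E m) =
      (\<Sum>m\<in>UNIV. \<Sum>s\<in>UNIV. (\<Sum>k\<in>UNIV. pd m (\<lambda>x. christoffel a x m s k) x * y $ k) * y $ s)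
      + v * (\<Sum>m\<in>UNIV. dsqnorm a x y m * u m)
      + 2 * \<alpha> * (\<Sum>m\<in>UNIV. \<Sum>j\<in>UNIV. pd m (\<lambda>x. s_mix a b x m j) x * y $ j)
      - 2 * (\<Sum>j\<in>UNIV. y $ j * (\<Sum>k\<in>UNIV. pd j (pd k f) x * y $ k))"
    unfolding E_def u_def by (simp add: sum.distrib sum_subtractf flip: sum_distrib_left sum_divide_distrib)
  moreover have "(\<Sum>j\<in>UNIV. y $ j * (\<Sum>k\<in>UNIV. \<tau>' j k * y $ k)) =
      (\<Sum>j\<in>UNIV. y $ j * (\<Sum>k\<in>UNIV. (\<Sum>m\<in>UNIV. pd j (\<lambda>x. christoffel a x m m k) x) * y $ k))
      - (n + 1) * (\<Sum>j\<in>UNIV. y $ j * (\<Sum>k\<in>UNIV. pd j (pd k f) x * y $ k))"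
    unfolding \<tau>'_def
    by (simp add: left_diff_distrib right_diff_distrib sum_subtractf sum_distrib_left mult_ac)
  moreover have "2 * (\<Sum>j\<in>UNIV. K j x y * \<tau> j x) = (\<Sum>j\<in>UNIV. geo a x y j * T j)
      + 2 * \<alpha> * (\<Sum>j\<in>UNIV. T j * u j) - 2 * g * (\<Sum>j\<in>UNIV. T j * y $ j)
      - (n + 1) * (\<Sum>j\<in>UNIV. d j * geo a x y j) - 2 * (n + 1) * \<alpha> * (\<Sum>j\<in>UNIV. d j * u j)
      + 2 * (n + 1) * g\<^sup>2"
  proof -
    have K\<tau>: "2 * (K j x y * \<tau> j x) =
        (geo a x y j + 2 * \<alpha> * u j - 2 * g * y $ j) * (T j - (n + 1) * d j)" for j
      by (simp add: field_simps K_def \<tau>_def \<alpha>_def u_def g_def T_def d_def)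
    have "2 * (\<Sum>j\<in>UNIV. K j x y * \<tau> j x) = (\<Sum>j\<in>UNIV. geo a x y j * T j)
      + 2 * \<alpha> * (\<Sum>j\<in>UNIV. T j * u j) - 2 * g * (\<Sum>j\<in>UNIV. T j * y $ j)
      - (n + 1) * (\<Sum>j\<in>UNIV. d j * geo a x y j) - 2 * (n + 1) * \<alpha> * (\<Sum>j\<in>UNIV. d j * u j)
      + 2 * (n + 1) * g * (\<Sum>j\<in>UNIV. d j * y $ j)"
      unfolding sum_distrib_left[of 2] K\<tau>
      by (simp add: sum_distrib_left algebra_simps sum.distrib sum_subtractf)
    then show ?thesis by (simp add: g[symmetric] power2_eq_square mult.assoc)
  qed
  moreover have "(\<Sum>m\<in>UNIV. C m m) = (\<Sum>j\<in>UNIV. T j * y $ j)"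
    unfolding C_def T_def by (rule trace_conn)
  ultimately show "Ric G x y = ?rhs"
    unfolding Ric_alpha[OF x] div_s_0_eq[OF x] hess_00_eq q
      d_def u_def g_def[symmetric] T_def C_def \<alpha>_def[symmetric] n_def[symmetric]
    by (simp add: algebra_simps)
qed

end

section \<open>Flatness in a chart\<close>

subsection \<open>Parity in the fibre variable\<close>

lemma conn_minus: "conn a x (- y) i s = - conn a x y i s"
  unfolding conn_def by (simp add: sum_negf)

lemma geo_minus: "geo a x (- y) i = geo a x y i"
  unfolding geo_def by (simp add: conn_minus)

lemma sqnorm_minus: "sqnorm a x (- y) = sqnorm a x y"
  unfolding sqnorm_def by simp

lemma s_low_0_minus: "s_low_0 a b x (- y) m = - s_low_0 a b x y m"
  unfolding s_low_0_def by (simp add: sum_negf)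

lemma s_up_0_minus: "s_up_0 a b x (- y) m = - s_up_0 a b x y m"
  unfolding s_up_0_def by (simp add: sum_negf)

lemma div_s_0_minus: "div_s_0 a b x (- y) = - div_s_0 a b x y"
  unfolding div_s_0_def by (simp add: sum_negf)

lemma grad_0_minus: "grad_0 f x (- y) = - grad_0 f x y"
  unfolding grad_0_def by (simp add: sum_negf)

lemma hess_00_minus: "hess_00 a f x (- y) = hess_00 a f x y"
  unfolding hess_00_def by simp

lemma (in metric_chart) Ric_alpha_minus:
  "x \<in> U \<Longrightarrow> Ric (finsler_spray (alpha a)) x (- y) = Ric (finsler_spray (alpha a)) x y"
  unfolding Ric_alpha by (simp add: geo_minus conn_minus sum_negf)

lemma (in metric_chart) Ric_alpha_zero: "x \<in> U \<Longrightarrow> Ric (finsler_spray (alpha a)) x 0 = 0"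
  unfolding Ric_alpha by (simp add: geo_def conn_def)

text \<open>The projective Ricci curvature is \<open>A + 2 \<alpha> B\<close> with \<open>A\<close> even and \<open>B\<close> odd in \<open>y\<close>. As \<open>\<alpha>\<close> is even,
  comparing \<open>y\<close> and \<open>-y\<close> shows that it vanishes precisely if \<open>A\<close> and \<open>B\<close> do.\<close>

lemma (in randers_chart) projectively_Ricci_flat_at_iff:
  assumes x: "x \<in> U" and \<sigma>: "smooth_on U \<sigma>" "\<And>x. x \<in> U \<Longrightarrow> \<sigma> x > 0"
    and f: "smooth_on U f"
    and f_eq: "\<And>x. x \<in> U \<Longrightarrow> f x = (1/4 * ln ((det (a x))\<^sup>2) - ln (\<sigma> x)) / (real CARD('n) + 1)"
  shows "(\<forall>y. y \<noteq> 0 \<longrightarrow> PRic (finsler_spray (randers a b)) \<sigma> x y = 0) \<longleftrightarrow>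
    (\<forall>y. Ric (finsler_spray (alpha a)) x y =
          2 * (\<Sum>m\<in>UNIV. s_low_0 a b x y m * s_up_0 a b x y m)
          + (alpha a x y)\<^sup>2 * (\<Sum>i\<in>UNIV. \<Sum>j\<in>UNIV. s_mix a b x i j * s_mix a b x j i)
          - (real CARD('n) - 1) * (hess_00 a f x y + (grad_0 f x y)\<^sup>2)
        \<and> div_s_0 a b x y = (real CARD('n) - 1) * (\<Sum>m\<in>UNIV. pd m f x * s_up_0 a b x y m))"
    (is "?flat \<longleftrightarrow> ?eqs")
proof -
  define A where "A = (\<lambda>y. Ric (finsler_spray (alpha a)) x y
      - 2 * (\<Sum>m\<in>UNIV. s_low_0 a b x y m * s_up_0 a b x y m)
      - sqnorm a x y * (\<Sum>i\<in>UNIV. \<Sum>j\<in>UNIV. s_mix a b x i j * s_mix a b x j i)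
      + (real CARD('n) - 1) * (hess_00 a f x y + (grad_0 f x y)\<^sup>2))"
  define B where "B = (\<lambda>y. div_s_0 a b x y - (real CARD('n) - 1) * (\<Sum>m\<in>UNIV. pd m f x * s_up_0 a b x y m))"
  have PRic: "PRic (finsler_spray (randers a b)) \<sigma> x y = A y + 2 * alpha a x y * B y" if "y \<noteq> 0" for y
    unfolding PRic_def A_def B_def
    by (rule Ric_projective[OF x that f projective_spray_randers[OF _ _ \<sigma> f_eq]])
  have even: "A (- y) = A y" for y
    unfolding A_def
    by (simp add: Ric_alpha_minus[OF x] s_low_0_minus s_up_0_minus sqnorm_minus hess_00_minus grad_0_minus)
  have odd: "B (- y) = - B y" for y
    unfolding B_def by (simp add: div_s_0_minus s_up_0_minus sum_negf)
  have zero: "A 0 = 0" "B 0 = 0"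
    unfolding A_def B_def
    by (simp_all add: Ric_alpha_zero[OF x] s_low_0_def s_up_0_def sqnorm_def hess_00_def grad_0_def div_s_0_def)
  have "?eqs \<longleftrightarrow> (\<forall>y. A y = 0 \<and> B y = 0)"
    unfolding A_def B_def alpha_square[OF x] by (intro iff_allI) (auto simp: algebra_simps)
  moreover have "?flat \<longleftrightarrow> (\<forall>y. A y = 0 \<and> B y = 0)"
  proof
    assume flat: ?flat
    show "\<forall>y. A y = 0 \<and> B y = 0"
    proof
      fix y
      show "A y = 0 \<and> B y = 0"
      proof (cases "y = 0")
        case False
        have "alpha a x (- y) = alpha a x y" by (simp add: alpha_eq sqnorm_minus)
        then have "A y + 2 * alpha a x y * B y = 0" "A y - 2 * alpha a x y * B y = 0"
          using flat PRic[OF False] PRic[of "- y"] False by (auto simp: even odd)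
        then show ?thesis using alpha_pos[OF x False] by simp
      qed (simp add: zero)
    qed
  qed (simp add: PRic)
  ultimately show ?thesis by simp
qed

section \<open>From the volume form to the function and back\<close>

lemma chart_inv_coord:
  assumes "topological_chart M c" "p \<in> fst c"
  shows "chart_inv c (snd c p) = p"
proof -
  have "topspace (subtopology M (fst c)) = fst c"
    using assms(1) openin_subset unfolding topological_chart_def by fastforce
  then have "inj_on (snd c) (fst c)"
    using assms(1) homeomorphic_imp_injective_map unfolding topological_chart_def by metis
  then show ?thesis using assms(2) by (simp add: chart_inv_def)
qed

lemma det_pullback:
  fixes J B :: "real ^ 'n ^ 'n::finite"
  shows "det (transpose J ** B ** J) = (det J)\<^sup>2 * det B"
  by (simp add: det_mul det_transpose power2_eq_square)

text \<open>The square of the determinant of the metric scales with the fourth power of the Jacobian determinant, so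
  its fourth root is a density.\<close>

lemma riemannian_density_pullback:
  fixes J B :: "real ^ 'n ^ 'n::finite"
  assumes "det J \<noteq> 0" "det B \<noteq> 0"
  shows "1/4 * ln ((det (transpose J ** B ** J))\<^sup>2) = ln \<bar>det J\<bar> + 1/4 * ln ((det B)\<^sup>2)"
proof -
  have "((det J)\<^sup>2 * det B)\<^sup>2 = \<bar>det J\<bar> ^ 4 * (det B)\<^sup>2"
    by (simp add: power_mult_distrib power_even_abs)
  moreover have "ln (\<bar>det J\<bar> ^ 4 * (det B)\<^sup>2) = ln (\<bar>det J\<bar> ^ 4) + ln ((det B)\<^sup>2)"
    using assms by (intro ln_mult_pos) auto
  moreover have "ln (\<bar>det J\<bar> ^ 4) = 4 * ln \<bar>det J\<bar>"
    using assms ln_realpow[of "\<bar>det J\<bar>" 4] by simp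
  ultimately show ?thesis unfolding det_pullback by simp
qed

locale randers_manifold =
  fixes M :: "'m topology" and A :: "('m, 'n::finite) chart set"
    and a :: "('m, 'n) chart \<Rightarrow> real ^ 'n \<Rightarrow> real ^ 'n ^ 'n"
    and b :: "('m, 'n) chart \<Rightarrow> real ^ 'n \<Rightarrow> real ^ 'n"
  assumes manifold: "smooth_manifold M A"
    and metric: "riemannian_metric A a"
    and form: "one_form A b"
    and norm: "\<forall>c\<in>A. \<forall>x\<in>coord_range c. one_form_norm (a c) (b c) x < 1"
begin

lemma chart: "c \<in> A \<Longrightarrow> topological_chart M c"
  using manifold unfolding smooth_manifold_def by blast

lemma open_coord_range: "c \<in> A \<Longrightarrow> open (coord_range c)"
  using chart unfolding topological_chart_def by blast

lemma chart_randers: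
  assumes "c \<in> A"
  shows "randers_chart (coord_range c) (a c) (b c)"
  using assms open_coord_range metric form norm
  unfolding riemannian_metric_def one_form_def by unfold_locales auto

lemma det_metric: "c \<in> A \<Longrightarrow> x \<in> coord_range c \<Longrightarrow> det (a c x) \<noteq> 0"
  using chart_randers unfolding randers_chart_def by (blast dest: metric_chart.det_nonzero)

lemma coord_range_cases:
  assumes "c \<in> A" "x \<in> coord_range c"
  obtains "chart_inv c x \<in> fst c" "snd c (chart_inv c x) = x"
  using assms chart_inv_coord[OF chart[OF assms(1)]] unfolding coord_range_def by auto

lemma overlap_facts:
  assumes "c \<in> A" "d \<in> A" "x \<in> overlap c d"
  shows "x \<in> coord_range c" "transition c d x \<in> coord_range d"
    "chart_inv d (transition c d x) = chart_inv c x"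
proof -
  obtain p where p: "p \<in> fst c" "p \<in> fst d" "x = snd c p"
    using assms(3) unfolding overlap_def by auto
  then have "chart_inv c x = p" using chart_inv_coord[OF chart[OF assms(1)]] by simp
  then show "x \<in> coord_range c" "transition c d x \<in> coord_range d"
    "chart_inv d (transition c d x) = chart_inv c x"
    using p chart_inv_coord[OF chart[OF assms(2)]] unfolding coord_range_def transition_def by auto
qed

lemma overlap_density:
  assumes "c \<in> A" "d \<in> A" "x \<in> overlap c d"
  shows "det (transition_jacobian c d x) \<noteq> 0"
    and "1/4 * ln ((det (a c x))\<^sup>2) =
      ln \<bar>det (transition_jacobian c d x)\<bar> + 1/4 * ln ((det (a d (transition c d x)))\<^sup>2)"
proof -
  have a: "a c x = transpose (transition_jacobian c d x) ** a d (transition c d x)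
      ** transition_jacobian c d x"
    using metric assms unfolding riemannian_metric_def by blast
  show J: "det (transition_jacobian c d x) \<noteq> 0"
    using det_metric[OF assms(1) overlap_facts(1)[OF assms]] unfolding a det_pullback by auto
  show "1/4 * ln ((det (a c x))\<^sup>2) =
      ln \<bar>det (transition_jacobian c d x)\<bar> + 1/4 * ln ((det (a d (transition c d x)))\<^sup>2)"
    unfolding a by (rule riemannian_density_pullback[OF J det_metric[OF assms(2) overlap_facts(2)[OF assms]]])
qed

lemma smooth_log_density:
  assumes "c \<in> A"
  shows "smooth_on (coord_range c) (\<lambda>x. 1/4 * ln ((det (a c x))\<^sup>2))"
proof -
  interpret randers_chart "coord_range c" "a c" "b c" by (rule chart_randers[OF assms])
  show ?thesis using det_nonzero by (intro smooth_intros open_U) auto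
qed

text \<open>The value at a point is read off in any chart around it: the Jacobian determinants cancel in the
  ratio of two densities.\<close>

lemma log_density_ratio:
  assumes \<sigma>: "volume_form A \<sigma>"
  obtains h where "smooth_scalar A h"
    and "\<And>c x. c \<in> A \<Longrightarrow> x \<in> coord_range c \<Longrightarrow>
      h (chart_inv c x) = (1/4 * ln ((det (a c x))\<^sup>2) - ln (\<sigma> c x)) / (real CARD('n) + 1)"
proof -
  define f where "f = (\<lambda>c x. (1/4 * ln ((det (a c x))\<^sup>2) - ln (\<sigma> c x)) / (real CARD('n) + 1))"
  define ch where "ch = (\<lambda>p. SOME c. c \<in> A \<and> p \<in> fst c)"
  define h where "h = (\<lambda>p. f (ch p) (snd (ch p) p))"
  have \<sigma>_pos: "\<sigma> c x > 0" if "c \<in> A" "x \<in> coord_range c" for c x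
    using \<sigma> that unfolding volume_form_def by blast
  have f_indep: "f c (snd c p) = f d (snd d p)" if "c \<in> A" "d \<in> A" "p \<in> fst c" "p \<in> fst d" for c d p
  proof -
    have x: "snd c p \<in> overlap c d" using that unfolding overlap_def by blast
    have t: "transition c d (snd c p) = snd d p"
      using chart_inv_coord[OF chart[OF that(1)] that(3)] by (simp add: transition_def)
    have "\<sigma> c (snd c p) = \<bar>det (transition_jacobian c d (snd c p))\<bar> * \<sigma> d (snd d p)"
      using \<sigma> that x t unfolding volume_form_def by metis
    then have "ln (\<sigma> c (snd c p)) = ln \<bar>det (transition_jacobian c d (snd c p))\<bar> + ln (\<sigma> d (snd d p))"
      using overlap_density(1)[OF that(1,2) x] \<sigma>_pos[OF that(2), of "snd d p"] that(4)
      by (simp add: ln_mult coord_range_def)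
    then show ?thesis unfolding f_def overlap_density(2)[OF that(1,2) x] t by simp
  qed
  have h_eq: "h (chart_inv c x) = f c x" if "c \<in> A" "x \<in> coord_range c" for c x
  proof (rule coord_range_cases[OF that])
    assume p: "chart_inv c x \<in> fst c" "snd c (chart_inv c x) = x"
    have "ch (chart_inv c x) \<in> A \<and> chart_inv c x \<in> fst (ch (chart_inv c x))"
      unfolding ch_def by (rule someI[of _ c]) (simp add: p that)
    then have "h (chart_inv c x) = f c (snd c (chart_inv c x))"
      unfolding h_def using f_indep that(1) p(1) by blast
    then show ?thesis using p(2) by simp
  qed
  have "smooth_scalar A h"
    unfolding smooth_scalar_def
  proof
    fix c assume c: "c \<in> A"
    have "smooth_on (coord_range c) (f c)"
      unfolding f_def using \<sigma> c \<sigma>_pos open_coord_range[OF c] unfolding volume_form_def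
      by (intro smooth_intros smooth_log_density) auto
    then show "smooth_on (coord_range c) (h \<circ> chart_inv c)"
      using smooth_on_cong[OF open_coord_range[OF c], of "h \<circ> chart_inv c" "f c"] h_eq[OF c] by simp
  qed
  then show ?thesis using that h_eq unfolding f_def by blast
qed

lemma volume_form_of_function:
  assumes h: "smooth_scalar A h"
  defines "\<sigma> \<equiv> \<lambda>c x. exp (1/4 * ln ((det (a c x))\<^sup>2) - (real CARD('n) + 1) * h (chart_inv c x))"
  shows "volume_form A \<sigma>"
  unfolding volume_form_def
proof (intro conjI ballI)
  fix c assume c: "c \<in> A"
  have "smooth_on (coord_range c) (\<lambda>x. h (chart_inv c x))"
    using h c unfolding smooth_scalar_def o_def by blast
  then show "smooth_on (coord_range c) (\<sigma> c)"
    unfolding \<sigma>_def using c by (intro smooth_intros smooth_log_density open_coord_range) 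
  show "\<sigma> c x > 0" for x by (simp add: \<sigma>_def)
  fix d x assume d: "d \<in> A" and x: "x \<in> overlap c d"
  show "\<sigma> c x = \<bar>det (transition_jacobian c d x)\<bar> * \<sigma> d (transition c d x)"
    unfolding \<sigma>_def overlap_facts(3)[OF c d x] overlap_density(2)[OF c d x]
    using overlap_density(1)[OF c d x] by (simp add: exp_add exp_diff)
qed

end

theorem theorem1p5:
  fixes M :: "'m topology"
    and A :: "('m, 'n::finite) chart set"
    and a :: "('m, 'n) chart \<Rightarrow> real ^ 'n \<Rightarrow> real ^ 'n ^ 'n"
    and b :: "('m, 'n) chart \<Rightarrow> real ^ 'n \<Rightarrow> real ^ 'n"
  assumes "smooth_manifold M A"
    and "riemannian_metric A a"
    and "one_form A b"
    and "\<forall>c\<in>A. \<forall>x\<in>coord_range c. one_form_norm (a c) (b c) x < 1"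
  shows "proj_Ricci_flat A (\<lambda>c. randers (a c) (b c)) \<longleftrightarrow>
    (\<exists>h :: 'm \<Rightarrow> real. smooth_scalar A h \<and>
      (\<forall>c\<in>A. \<forall>x\<in>coord_range c. \<forall>y.
        let f = h \<circ> chart_inv c; n = real CARD('n) in
        Ric (finsler_spray (alpha (a c))) x y =
          2 * (\<Sum>m\<in>UNIV. s_low_0 (a c) (b c) x y m * s_up_0 (a c) (b c) x y m)
          + (alpha (a c) x y)\<^sup>2 *
              (\<Sum>i\<in>UNIV. \<Sum>j\<in>UNIV. s_mix (a c) (b c) x i j * s_mix (a c) (b c) x j i)
          - (n - 1) * (hess_00 (a c) f x y + (grad_0 f x y)\<^sup>2)
        \<and> div_s_0 (a c) (b c) x y =
          (n - 1) * (\<Sum>m\<in>UNIV. pd m f x * s_up_0 (a c) (b c) x y m)))"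
proof -
  interpret randers_manifold M A a b using assms by unfold_locales
  define eqs where "eqs = (\<lambda>h c x. \<forall>y.
        let f = h \<circ> chart_inv c; n = real CARD('n) in
        Ric (finsler_spray (alpha (a c))) x y =
          2 * (\<Sum>m\<in>UNIV. s_low_0 (a c) (b c) x y m * s_up_0 (a c) (b c) x y m)
          + (alpha (a c) x y)\<^sup>2 *
              (\<Sum>i\<in>UNIV. \<Sum>j\<in>UNIV. s_mix (a c) (b c) x i j * s_mix (a c) (b c) x j i)
          - (n - 1) * (hess_00 (a c) f x y + (grad_0 f x y)\<^sup>2)
        \<and> div_s_0 (a c) (b c) x y =
          (n - 1) * (\<Sum>m\<in>UNIV. pd m f x * s_up_0 (a c) (b c) x y m))"
  have local: "(\<forall>y. y \<noteq> 0 \<longrightarrow> PRic (finsler_spray (randers (a c) (b c))) (\<sigma> c) x y = 0) \<longleftrightarrow> eqs h c x"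
    if "volume_form A \<sigma>" "smooth_scalar A h" "c \<in> A" "x \<in> coord_range c"
      and "\<And>x. x \<in> coord_range c \<Longrightarrow> h (chart_inv c x) =
        (1/4 * ln ((det (a c x))\<^sup>2) - ln (\<sigma> c x)) / (real CARD('n) + 1)" for \<sigma> h c x
    unfolding eqs_def Let_def
    by (rule randers_chart.projectively_Ricci_flat_at_iff[OF chart_randers[OF that(3)] that(4)])
      (use that in \<open>auto simp: volume_form_def smooth_scalar_def\<close>)
  have "proj_Ricci_flat A (\<lambda>c. randers (a c) (b c)) \<longleftrightarrow>
      (\<exists>h. smooth_scalar A h \<and> (\<forall>c\<in>A. \<forall>x\<in>coord_range c. eqs h c x))"
  proof
    assume "proj_Ricci_flat A (\<lambda>c. randers (a c) (b c))"
    then obtain \<sigma> where \<sigma>: "volume_form A \<sigma>"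
      and flat: "\<And>c x. c \<in> A \<Longrightarrow> x \<in> coord_range c \<Longrightarrow>
        \<forall>y. y \<noteq> 0 \<longrightarrow> PRic (finsler_spray (randers (a c) (b c))) (\<sigma> c) x y = 0"
      unfolding proj_Ricci_flat_def proj_Ricci_flat_spray_def by blast
    obtain h where h: "smooth_scalar A h"
      "\<And>c x. c \<in> A \<Longrightarrow> x \<in> coord_range c \<Longrightarrow>
        h (chart_inv c x) = (1/4 * ln ((det (a c x))\<^sup>2) - ln (\<sigma> c x)) / (real CARD('n) + 1)"
      using log_density_ratio[OF \<sigma>] by blast
    then show "\<exists>h. smooth_scalar A h \<and> (\<forall>c\<in>A. \<forall>x\<in>coord_range c. eqs h c x)"
      using local[OF \<sigma> h(1) _ _ h(2)] flat by blast
  next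
    assume "\<exists>h. smooth_scalar A h \<and> (\<forall>c\<in>A. \<forall>x\<in>coord_range c. eqs h c x)"
    then obtain h where h: "smooth_scalar A h"
      and eqs: "\<And>c x. c \<in> A \<Longrightarrow> x \<in> coord_range c \<Longrightarrow> eqs h c x" by blast
    define \<sigma> where "\<sigma> = (\<lambda>c x. exp (1/4 * ln ((det (a c x))\<^sup>2) - (real CARD('n) + 1) * h (chart_inv c x)))"
    have \<sigma>: "volume_form A \<sigma>" unfolding \<sigma>_def by (rule volume_form_of_function[OF h])
    have "h (chart_inv c x) = (1/4 * ln ((det (a c x))\<^sup>2) - ln (\<sigma> c x)) / (real CARD('n) + 1)" for c x
      by (simp add: \<sigma>_def field_simps)
    then have "\<forall>c\<in>A. \<forall>x\<in>coord_range c. \<forall>y. y \<noteq> 0 \<longrightarrow>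
        PRic (finsler_spray (randers (a c) (b c))) (\<sigma> c) x y = 0"
      using local[OF \<sigma> h] eqs by blast
    then show "proj_Ricci_flat A (\<lambda>c. randers (a c) (b c))"
      using \<sigma> unfolding proj_Ricci_flat_def proj_Ricci_flat_spray_def by blast
  qed
  then show ?thesis unfolding eqs_def .
qed

end
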